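(* Let $A=\{a_1,\dots,a_n\}\subset\mathbb{R}^d$ be a configuration of $n\ge d+3$ labeled points in general position that is the vertex set of a $k$-neighborly $d$-polytope $P$. Let $\widehat A\subset\mathbb{R}^{d+1}$ be a lex-lifting of $A$ and let $\widehat{\widehat A}\subset\mathbb{R}^{d+2}$ be a positive lex-lifting of $\widehat A$ (both with respect to the given labeling order). Put $\widehat{\widehat P}:=\operatorname{conv}(\widehat{\widehat A})$. Then: (i) $\widehat{\widehat P}$ is a $(k+1)$-neighborly $(d+2)$-polytope; in particular, if $P$ is neighborly, so is $\widehat{\widehat P}$. (ii) For each smooth strictly convex body $K\subset\mathbb{R}^{d+2}$ there is a $K$-inscribed polytope that is combinatorially equivalent to $\widehat{\widehat P}$. That is, $\widehat{\widehat P}$ is a $K$-inscribable $(k+1)$-neighborly $(d+2)$-polytope for every such $K$.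
   Context: A $d$-polytope is a $d$-dimensional convex polytope. A configuration in $\mathbb{R}^d$ is in general position if no $d+1$ of its points lie in a common hyperplane. A polytope is $k$-neighborly if every subset of $k$ of its vertices is the vertex set of a face; a $d$-polytope is neighborly if it is $\lfloor d/2\rfloor$-neighborly. Two polytopes are combinatorially equivalent if their face lattices agree (as posets of subsets of vertex labels, for vertex-labeled polytopes). Convex bodies: a convex body is a full-dimensional compact convex set; it is strictly convex if its boundary contains no segment, and smooth if every boundary point has a unique supporting hyperplane. A polytope is $K$-inscribed if all its vertices lie on $\partial K$, and $K$-inscribable if it is combinatorially equivalent to a $K$-inscribed polytope. Lex-liftings: for a hyperplane $H=\{x:\langle x,v\rangle=c\}$ with normal vector $v$ whose last coordinate is positive, a point $a$ is above (resp. below) $H$ if $\langle a,v\rangle>c$ (resp. $<c$). Let $X=\{x_1,\dots,x_n\}\subset\mathbb{R}^m$ be a configuration of $n\ge m+2$ labeled points. A lex-lifting of $X$ is a labeled configuration $\widehat X=\{\widehat x_1,\dots,\widehat x_n\}\subset\mathbb{R}^{m+1}$ with $\widehat x_i=(x_i,h_i)$ for some heights $h_i\in\mathbb{R}$ such that for each $i\ge m+2$ one has $h_i\ne0$ and $|h_i|$ is large enough that $\widehat x_i$ is above (if $h_i>0$) or below (if $h_i<0$) every hyperplane spanned by points of $\{\widehat x_1,\dots,\widehat x_{i-1}\}$. It is positive if $h_i\ge0$ for all $1\le i\le n$. (For $X$ in general position, no hyperplane spanned by points of $\{\widehat x_1,\dots,\widehat x_{i-1}\}$ is vertical, and $\widehat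 X$ is again in general position.) *)

theory Defs
  imports "HOL-Analysis.Analysis"
begin

text \<open>
  \<open>\<real>\<^sup>d\<close> is an arbitrary Euclidean space \<open>'a\<close> with \<open>d = DIM('a)\<close>; then \<open>\<real>\<^sup>d\<^sup>+\<^sup>1\<close> is \<open>'a \<times> real\<close>
  (whose last coordinate is \<^const>\<open>snd\<close>) and \<open>\<real>\<^sup>d\<^sup>+\<^sup>2\<close> is \<open>('a \<times> real) \<times> real\<close>.
  A configuration of \<open>n\<close> labeled points is a function on \<open>nat\<close>, of which only the
  values on the labels \<open>{1..n}\<close> matter.
\<close>

definition hyperplane :: "'a::euclidean_space set \<Rightarrow> bool" where
  "hyperplane H \<longleftrightarrow> (\<exists>v c. v \<noteq> 0 \<and> H = {x. v \<bullet> x = c})"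

definition general_position :: "'a::euclidean_space set \<Rightarrow> bool" where
  "general_position X \<longleftrightarrow>
     (\<forall>S. S \<subseteq> X \<and> card S = DIM('a) + 1 \<longrightarrow> \<not> (\<exists>H. hyperplane H \<and> S \<subseteq> H))"

definition vertices :: "'a::euclidean_space set \<Rightarrow> 'a set" where
  "vertices P = {x. x extreme_point_of P}"

definition dim_polytope :: "nat \<Rightarrow> 'a::euclidean_space set \<Rightarrow> bool" where
  "dim_polytope d P \<longleftrightarrow> polytope P \<and> aff_dim P = int d"

definition k_neighborly :: "nat \<Rightarrow> 'a::euclidean_space set \<Rightarrow> bool" where
  "k_neighborly k P \<longleftrightarrow> polytope P \<and>
     (\<forall>S. S \<subseteq> vertices P \<and> card S = k \<longrightarrow> (\<exists>F. F face_of P \<and> vertices F = S))"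

definition neighborly :: "'a::euclidean_space set \<Rightarrow> bool" where
  "neighborly P \<longleftrightarrow> (\<exists>d. dim_polytope d P \<and> k_neighborly (d div 2) P)"

definition vertex_labeling :: "nat \<Rightarrow> (nat \<Rightarrow> 'a::euclidean_space) \<Rightarrow> 'a set \<Rightarrow> bool" where
  "vertex_labeling n a P \<longleftrightarrow> bij_betw a {1..n} (vertices P)"

text \<open>The face lattice of a vertex-labeled polytope, as a family of label sets ordered by
  inclusion; the empty face and the polytope itself are included.\<close>

definition face_lattice :: "nat \<Rightarrow> (nat \<Rightarrow> 'a::euclidean_space) \<Rightarrow> 'a set \<Rightarrow> nat set set" where
  "face_lattice n a P = {I. I \<subseteq> {1..n} \<and> (\<exists>F. F face_of P \<and> vertices F = a ` I)}"

definition combinatorially_equivalent ::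
    "nat \<Rightarrow> (nat \<Rightarrow> 'a::euclidean_space) \<Rightarrow> 'a set \<Rightarrow> (nat \<Rightarrow> 'b::euclidean_space) \<Rightarrow> 'b set \<Rightarrow> bool" where
  "combinatorially_equivalent n a P b Q \<longleftrightarrow>
     polytope P \<and> vertex_labeling n a P \<and> polytope Q \<and> vertex_labeling n b Q \<and>
     face_lattice n a P = face_lattice n b Q"

definition convex_body :: "'a::euclidean_space set \<Rightarrow> bool" where
  "convex_body K \<longleftrightarrow> compact K \<and> convex K \<and> aff_dim K = int DIM('a)"

definition strictly_convex_body :: "'a::euclidean_space set \<Rightarrow> bool" where
  "strictly_convex_body K \<longleftrightarrow> convex_body K \<and>
     \<not> (\<exists>x y. x \<noteq> y \<and> closed_segment x y \<subseteq> frontier K)"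

definition supporting_hyperplane_at :: "'a::euclidean_space set \<Rightarrow> 'a \<Rightarrow> 'a set \<Rightarrow> bool" where
  "supporting_hyperplane_at K x H \<longleftrightarrow>
     (\<exists>v c. v \<noteq> 0 \<and> H = {y. v \<bullet> y = c} \<and> x \<in> H \<and> K \<subseteq> {y. v \<bullet> y \<le> c})"

definition smooth_body :: "'a::euclidean_space set \<Rightarrow> bool" where
  "smooth_body K \<longleftrightarrow> convex_body K \<and> (\<forall>x \<in> frontier K. \<exists>!H. supporting_hyperplane_at K x H)"

definition inscribed :: "'a::euclidean_space set \<Rightarrow> 'a set \<Rightarrow> bool" where
  "inscribed K Q \<longleftrightarrow> polytope Q \<and> vertices Q \<subseteq> frontier K"

definition spanned_hyperplane :: "'a::euclidean_space set \<Rightarrow> 'a set \<Rightarrow> bool" where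
  "spanned_hyperplane X H \<longleftrightarrow> hyperplane H \<and> (\<exists>S \<subseteq> X. affine hull S = H)"

text \<open>A point is neither above nor below a vertical hyperplane.\<close>

definition above :: "'a::euclidean_space \<times> real \<Rightarrow> ('a \<times> real) set \<Rightarrow> bool" where
  "above x H \<longleftrightarrow> (\<exists>v c. snd v > 0 \<and> H = {y. y \<bullet> v = c} \<and> x \<bullet> v > c)"

definition below :: "'a::euclidean_space \<times> real \<Rightarrow> ('a \<times> real) set \<Rightarrow> bool" where
  "below x H \<longleftrightarrow> (\<exists>v c. snd v > 0 \<and> H = {y. y \<bullet> v = c} \<and> x \<bullet> v < c)"

text \<open>\<open>y\<close> is a lex-lifting of \<open>x\<close>, with heights \<open>h i = snd (y i)\<close>.\<close>

definition lex_lifting ::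
    "nat \<Rightarrow> (nat \<Rightarrow> 'a::euclidean_space) \<Rightarrow> (nat \<Rightarrow> 'a \<times> real) \<Rightarrow> bool" where
  "lex_lifting n x y \<longleftrightarrow>
     (\<forall>i \<in> {1..n}. fst (y i) = x i) \<and>
     (\<forall>i \<in> {DIM('a) + 2..n}. snd (y i) \<noteq> 0 \<and>
        (\<forall>H. spanned_hyperplane (y ` {1..<i}) H \<longrightarrow>
           (snd (y i) > 0 \<longrightarrow> above (y i) H) \<and> (snd (y i) < 0 \<longrightarrow> below (y i) H)))"

definition positive_lex_lifting ::
    "nat \<Rightarrow> (nat \<Rightarrow> 'a::euclidean_space) \<Rightarrow> (nat \<Rightarrow> 'a \<times> real) \<Rightarrow> bool" where
  "positive_lex_lifting n x y \<longleftrightarrow> lex_lifting n x y \<and> (\<forall>i \<in> {1..n}. snd (y i) \<ge> 0)"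

end

theory Submission
  imports Defs
begin

text \<open>
  The proof works with the signs that affine functionals \<open>q \<mapsto> v \<bullet> q + c\<close> take on the labeled
  points, that is, with the covectors of the oriented matroid of the configuration. They determine
  the face lattice: \<open>I\<close> is the vertex set of a face exactly if the vector that is \<open>0\<close> on \<open>I\<close> and
  positive elsewhere is a covector (\<open>face_lattice_covectors\<close>).

  The covectors of a lex-lifting depend only on the covectors of the base configuration and on the
  signs of the heights (\<open>covectors_lex_lift\<close>). The reason is that the functionals with last
  coefficient \<open>1\<close> and prescribed weak signs on the first \<open>N\<close> lifted points form a pointed
  polyhedron. Its vertices are spanned hyperplanes, and all of these have the next point on the
  same side, so the next point can be brought to the other side only along a recession direction
  of the polyhedron; such a direction is a functional on the base (\<open>spanned_or_recession\<close>).

  Neighborliness is proved by adding the points one at a time and showing that every set \<open>S\<close> of at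
  most \<open>k + 1\<close> labels is a face of the lower hull of the points present so far
  (\<open>double_lift_lower_faces\<close>). If the new point is not in \<open>S\<close>, it lies above some hyperplane that
  supports the old points exactly in \<open>S\<close>. If it is in \<open>S\<close>, the other points of \<open>S\<close> form a face of
  the base polytope, hence a face of both the upper and the lower hull of its first lift, and one of
  these two hulls is visible from the new point. A functional vanishing on that visible face tilts
  the supporting hyperplane until it reaches the new point.

  For a smooth strictly convex body \<open>K\<close> let \<open>p\<close> be its lowest point. The projective map
  \<open>(x, t) \<mapsto> (x / t, 1 / t)\<close> centered at \<open>p\<close> moves the supporting hyperplane at \<open>p\<close> to infinity and
  turns the part of the boundary of \<open>K\<close> outside \<open>p\<close> into the graph of a function. Smoothness makes
  this function defined everywhere, since every upward ray from \<open>p\<close> enters \<open>K\<close>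
  (\<open>upward_ray_enters\<close>); strict convexity makes it grow faster than every affine function, since
  boundary points in steeper and steeper directions can only converge to \<open>p\<close>
  (\<open>radial_points_converge\<close>). Hence if the heights of a lex-lifting of \<open>A\<close> are chosen one after
  the other, large enough and with the given signs, the corresponding points of the graph are a
  positive lex-lifting of it (\<open>inscribed_configuration\<close>). They have the covectors of the given
  double lifting, and so do their preimages on the boundary of \<open>K\<close>.
\<close>

section \<open>Signs of affine functionals on a configuration\<close>

definition covectors :: "nat \<Rightarrow> (nat \<Rightarrow> 'a::euclidean_space) \<Rightarrow> (nat \<Rightarrow> real) set" where
  "covectors N x = {s. \<exists>v c. \<forall>i\<in>{1..N}. sgn (v \<bullet> x i + c) = s i}"

text \<open>
  Normalizing the last coefficient to \<open>1\<close> loses nothing among functionals that increase upwards.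
  A nonnegative upper covector describes a face of the lower hull.
\<close>

definition upper_covectors :: "nat \<Rightarrow> (nat \<Rightarrow> 'a::euclidean_space \<times> real) \<Rightarrow> (nat \<Rightarrow> real) set" where
  "upper_covectors N y = {s. \<exists>v c. snd v = 1 \<and> (\<forall>i\<in>{1..N}. sgn (v \<bullet> y i + c) = s i)}"

text \<open>
  The points labeled by \<open>J\<close> affinely span the whole space; stated dually, this is the form in which
  it is used to show that a functional vanishes.
\<close>

definition spanning :: "nat set \<Rightarrow> (nat \<Rightarrow> 'a::euclidean_space) \<Rightarrow> bool" where
  "spanning J x \<longleftrightarrow> (\<forall>v c. (\<forall>i\<in>J. v \<bullet> x i + c = 0) \<longrightarrow> v = 0)"

text \<open>
  The weak relaxation of having the same signs: \<open>f\<close> lies in the closure of the cone of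
  value vectors that have the signs of \<open>s\<close>.
\<close>

definition conformal :: "nat \<Rightarrow> (nat \<Rightarrow> real) \<Rightarrow> (nat \<Rightarrow> real) \<Rightarrow> bool" where
  "conformal N s f \<longleftrightarrow> (\<forall>i\<in>{1..N}. 0 \<le> s i * f i \<and> (s i = 0 \<longrightarrow> f i = 0))"

text \<open>
  The side condition of a lex-lifting, with \<open>e i\<close> recording the side. It speaks only of hyperplanes
  that are graphs, so it can be imposed while heights are still being chosen, before anything is
  known about the general position of the lifted points.
\<close>

definition lex_signed :: "(nat \<Rightarrow> real) \<Rightarrow> nat \<Rightarrow> (nat \<Rightarrow> 'a::euclidean_space \<times> real) \<Rightarrow> bool" where
  "lex_signed e n y \<longleftrightarrow> (\<forall>i\<in>{DIM('a) + 2..n}. \<forall>v c. snd v = 1 \<longrightarrow>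
     spanned_hyperplane (y ` {1..<i}) {q. v \<bullet> q + c = 0} \<longrightarrow> 0 < e i * (v \<bullet> y i + c))"

lemma spanning_mono: "spanning I x \<Longrightarrow> I \<subseteq> J \<Longrightarrow> spanning J x"
  unfolding spanning_def by blast

lemma spanning_aff_dim:
  fixes x :: "nat \<Rightarrow> 'a::euclidean_space"
  assumes "spanning J x"
  shows "aff_dim (x ` J) = int DIM('a)"
proof (rule ccontr)
  assume "\<not> ?thesis"
  then have "aff_dim (x ` J) < int DIM('a)"
    using aff_dim_le_DIM[of "x ` J"] by linarith
  then obtain a b where ab: "a \<noteq> 0" "x ` J \<subseteq> {q. a \<bullet> q = b}"
    using aff_lowdim_subset_hyperplane by blast
  then have "\<forall>i\<in>J. a \<bullet> x i + (- b) = 0" by auto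
  then show False using assms ab(1) unfolding spanning_def by blast
qed

text \<open>
  Any \<open>DIM('a) + 1\<close> spanning points are affinely independent, so affine functionals take arbitrary
  values on them.
\<close>

lemma interpolation:
  fixes x :: "nat \<Rightarrow> 'a::euclidean_space"
  assumes "finite J" "card J = DIM('a) + 1" "spanning J x"
  shows "\<exists>v c. \<forall>i\<in>J. v \<bullet> x i + c = r i"
proof -
  have dim: "aff_dim (x ` J) = int DIM('a)"
    using spanning_aff_dim[OF assms(3)] .
  have "aff_dim (x ` J) \<le> int (card (x ` J)) - 1"
    using assms(1) by (intro aff_dim_le_card) auto
  moreover have "card (x ` J) \<le> card J" using assms(1) by (rule card_image_le)
  ultimately have card: "card (x ` J) = card J" using dim assms(2) by linarith
  then have inj: "inj_on x J" using assms(1) by (metis eq_card_imp_inj_on)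
  have indep: "\<not> affine_dependent (x ` J)"
    using affine_independent_iff_card[of "x ` J"] dim card assms by simp
  obtain j where j: "j \<in> J" using assms(2) by fastforce
  let ?T = "(\<lambda>q. - x j + q) ` (x ` J - {x j})"
  have "independent ?T"
    using affine_dependent_iff_dependent2[of "x j" "x ` J"] indep j by auto
  then obtain g where g: "linear g"
    "\<forall>q\<in>?T. g q = r (inv_into J x (q + x j)) - r j"
    using linear_independent_extend[of ?T "\<lambda>q. r (inv_into J x (q + x j)) - r j"] by auto
  define v where "v = adjoint g (1::real)"
  have v: "g q = v \<bullet> q" for q
    using adjoint_works[OF g(1), of q "1::real"] by (simp add: v_def inner_commute)
  have "v \<bullet> x i + (r j - v \<bullet> x j) = r i" if i: "i \<in> J" for i
  proof (cases "i = j")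
    case False
    then have "x i \<noteq> x j" using inj i j by (meson inj_onD)
    then have "- x j + x i \<in> ?T" using i by blast
    then have "g (- x j + x i) = r (inv_into J x (- x j + x i + x j)) - r j"
      using g(2) by blast
    then have "g (- x j + x i) = r i - r j"
      using i inj by (simp add: inv_into_f_f)
    then show ?thesis by (simp add: v inner_add_right inner_diff_right)
  qed simp
  then show ?thesis by blast
qed

text \<open>
  A graph hyperplane projects isomorphically to the base, so it is spanned by lifted points as soon as
  their projections span the base.
\<close>

lemma affine_hull_graph:
  fixes y :: "nat \<Rightarrow> 'a::euclidean_space \<times> real"
  assumes "snd v = 1" "spanning Z (fst \<circ> y)" "\<And>i. i \<in> Z \<Longrightarrow> v \<bullet> y i + c = 0"
  shows "affine hull (y ` Z) = {q. v \<bullet> q + c = 0}"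
proof
  have H: "{q. v \<bullet> q + c = 0} = {q. v \<bullet> q = - c}" by auto
  then have "affine {q. v \<bullet> q + c = 0}" by (simp add: affine_hyperplane)
  then show sub: "affine hull (y ` Z) \<subseteq> {q. v \<bullet> q + c = 0}"
    using assms(3) by (intro hull_minimal) auto
  have "affine hull ((fst \<circ> y) ` Z) = UNIV"
    using spanning_aff_dim[OF assms(2)] affine_hull_UNIV aff_dim_eq_full by blast
  then have fst: "fst ` (affine hull (y ` Z)) = UNIV"
    using affine_hull_linear_image[of fst "y ` Z"]
    by (simp add: image_comp bounded_linear_fst)
  show "{q. v \<bullet> q + c = 0} \<subseteq> affine hull (y ` Z)"
  proof
    fix q assume q: "q \<in> {q. v \<bullet> q + c = 0}"
    obtain q' where q': "q' \<in> affine hull (y ` Z)" "fst q' = fst q"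
      using fst by (metis UNIV_I image_iff)
    then have "v \<bullet> q' + c = 0" using sub by blast
    then have "snd q' = snd q" using q q'(2) assms(1) by (simp add: inner_prod_def)
    then show "q \<in> affine hull (y ` Z)" using q' by (metis prod.expand)
  qed
qed

section \<open>Supporting functionals of a lifted configuration\<close>

text \<open>
  This is the decomposition of a polyhedron into vertices and recession directions, for the polyhedron
  of functionals with last coefficient \<open>1\<close> that conform to the given signs. If a linear expression
  (here, \<open>e\<close> times the value at \<open>p\<close>) is nonpositive somewhere on the polyhedron, then it is
  nonpositive at a vertex or negative along a recession direction. A vertex is a functional with as
  many zeros as possible, which then spans its zero hyperplane; a recession direction does not
  change the last coefficient, so it is a functional on the base. With \<open>e = 0\<close> the second
  alternative is void and the lemma produces a vertex.
\<close>

lemma spanned_or_recession: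
  fixes y :: "nat \<Rightarrow> 'a::euclidean_space \<times> real"
  assumes span: "spanning {1..N} (fst \<circ> y)" and v: "snd v = 1" and p: "e * (v \<bullet> p + c) \<le> 0"
  shows "(\<exists>v' c'. snd v' = 1 \<and> spanned_hyperplane (y ` {1..N}) {q. v' \<bullet> q + c' = 0} \<and>
            conformal N (\<lambda>i. v \<bullet> y i + c) (\<lambda>i. v' \<bullet> y i + c') \<and> e * (v' \<bullet> p + c') \<le> 0) \<or>
         (\<exists>u b. conformal N (\<lambda>i. v \<bullet> y i + c) (\<lambda>i. u \<bullet> fst (y i) + b) \<and> e * (u \<bullet> fst p + b) < 0)"
proof -
  define s where "s = (\<lambda>i. v \<bullet> y i + c)"
  define val where "val = (\<lambda>w i. fst w \<bullet> y i + snd w)"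
  define feas where "feas = (\<lambda>w. snd (fst w) = 1 \<and> conformal N s (val w) \<and> e * (fst w \<bullet> p + snd w) \<le> 0)"
  define zeros where "zeros = (\<lambda>w. {i\<in>{1..N}. val w i = 0})"
  have "feas (v, c)" using v p by (auto simp: feas_def conformal_def s_def val_def)
  moreover have bound: "\<forall>w. feas w \<longrightarrow> card (zeros w) < Suc N"
  proof (intro allI impI)
    fix w
    have "card (zeros w) \<le> card {1..N}" unfolding zeros_def by (intro card_mono) auto
    then show "card (zeros w) < Suc N" by simp
  qed
  ultimately obtain w where w: "feas w" and max: "\<And>w'. feas w' \<Longrightarrow> card (zeros w') \<le> card (zeros w)"
    using ex_has_greatest_nat[of feas "(v, c)" "\<lambda>w. card (zeros w)" "Suc N"] by (metis less_imp_le)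
  obtain v1 c1 where vc: "w = (v1, c1)" by (cases w)
  have v1: "snd v1 = 1" using w by (simp add: feas_def vc)
  have conf: "conformal N s (val w)" and ep: "e * (v1 \<bullet> p + c1) \<le> 0"
    using w by (auto simp: feas_def vc)
  show ?thesis
  proof (cases "spanning (zeros w) (fst \<circ> y)")
    case True
    have "affine hull (y ` zeros w) = {q. v1 \<bullet> q + c1 = 0}"
      by (rule affine_hull_graph[OF v1 True]) (auto simp: zeros_def val_def vc)
    moreover have "hyperplane {q. v1 \<bullet> q + c1 = 0}"
      unfolding hyperplane_def using v1
      by (intro exI[of _ v1] exI[of _ "- c1"]) auto
    ultimately have "spanned_hyperplane (y ` {1..N}) {q. v1 \<bullet> q + c1 = 0}"
      unfolding spanned_hyperplane_def
      by (intro conjI exI[of _ "y ` zeros w"] image_mono) (auto simp: zeros_def)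
    moreover have "conformal N (\<lambda>i. v \<bullet> y i + c) (\<lambda>i. v1 \<bullet> y i + c1)"
      using conf by (simp add: s_def val_def vc)
    ultimately show ?thesis using v1 ep by blast
  next
    case False
    then obtain u b where ub: "u \<noteq> 0" "\<And>i. i \<in> zeros w \<Longrightarrow> u \<bullet> fst (y i) + b = 0"
      unfolding spanning_def by auto
    \<comment> \<open>Otherwise, moving along the direction would lead to an admissible functional with more zeros.\<close>
    have conformal_dir: "conformal N s (\<lambda>i. u' \<bullet> fst (y i) + b')"
      if z: "\<And>i. i \<in> zeros w \<Longrightarrow> u' \<bullet> fst (y i) + b' = 0" and neg: "e * (u' \<bullet> fst p + b') \<le> 0" for u' b'
    proof (rule ccontr)
      define g where "g = (\<lambda>i. u' \<bullet> fst (y i) + b')"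
      define W where "W = {i\<in>{1..N}. val w i * g i < 0}"
      assume "\<not> ?thesis"
      then obtain i where i: "i \<in> {1..N}" "s i * g i < 0 \<or> (s i = 0 \<and> g i \<noteq> 0)"
        unfolding conformal_def g_def by force
      have "i \<notin> zeros w" using z i by (auto simp: g_def)
      then have "val w i \<noteq> 0" using i(1) by (auto simp: zeros_def)
      then have "s i * val w i > 0" using conf i(1) unfolding conformal_def
        by (metis mult_eq_0_iff order_less_le)
      then have "i \<in> W" using i by (auto simp: W_def zero_less_mult_iff mult_less_0_iff)
      then have W: "finite W" "W \<noteq> {}" by (auto simp: W_def)
      \<comment> \<open>The first time at which a value moving towards zero reaches it.\<close>
      define \<tau> where "\<tau> = Min ((\<lambda>i. - val w i / g i) ` W)"
      have \<tau>_le: "\<tau> \<le> - val w i / g i" if "i \<in> W" for i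
        unfolding \<tau>_def using W that by (intro Min_le) auto
      have "\<tau> \<in> (\<lambda>i. - val w i / g i) ` W"
        unfolding \<tau>_def using W by (intro Min_in) auto
      then obtain k where k: "k \<in> W" "\<tau> = - val w k / g k" by blast
      have \<tau>0: "\<tau> > 0" using k by (auto simp: W_def mult_less_0_iff field_simps)
      define w' where "w' = (v1 + (\<tau> *\<^sub>R u', 0), c1 + \<tau> * b')"
      have val': "val w' i = val w i + \<tau> * g i" for i
        by (simp add: val_def w'_def vc g_def inner_prod_def algebra_simps)
      have same: "0 \<le> val w i * val w' i \<and> (val w i = 0 \<longrightarrow> val w' i = 0)" if "i \<in> {1..N}" for i
      proof (cases "i \<in> W")
        case True
        then consider "val w i > 0" "g i < 0" | "val w i < 0" "g i > 0"
          by (auto simp: W_def mult_less_0_iff)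
        then show ?thesis
        proof cases
          case 1
          then have "val w' i \<ge> 0" using \<tau>_le[OF True] by (simp add: val' field_simps)
          then show ?thesis using 1 by simp
        next
          case 2
          then have "val w' i \<le> 0" using \<tau>_le[OF True] by (simp add: val' field_simps)
          then show ?thesis using 2 by (simp add: mult_nonpos_nonpos)
        qed
      next
        case False
        then have "0 \<le> val w i * g i" using that by (simp add: W_def)
        then have "0 \<le> val w i * val w i + \<tau> * (val w i * g i)" using \<tau>0 by simp
        moreover have "val w i = 0 \<longrightarrow> g i = 0" using z that by (auto simp: zeros_def g_def)
        ultimately show ?thesis by (auto simp: val' algebra_simps)
      qed
      have "conformal N s (val w')"
        using conf same unfolding conformal_def
        by (smt (verit) mult_eq_0_iff zero_le_mult_iff)
      moreover have "e * (fst w' \<bullet> p + snd w') = e * (v1 \<bullet> p + c1) + \<tau> * (e * (u' \<bullet> fst p + b'))"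
        by (simp add: w'_def inner_prod_def algebra_simps)
      then have "e * (fst w' \<bullet> p + snd w') \<le> 0"
        using ep neg \<tau>0 by (simp add: mult_nonneg_nonpos add_nonpos_nonpos)
      ultimately have "feas w'" using v1 by (simp add: feas_def w'_def)
      moreover have "zeros w \<subseteq> zeros w'" using same unfolding zeros_def by blast
      have kN: "k \<in> {1..N}" "val w k * g k < 0" using k(1) by (simp_all add: W_def)
      have "val w' k = 0" using kN(2) k(2) by (auto simp: val')
      then have "k \<in> zeros w'" "k \<notin> zeros w" using kN by (auto simp: zeros_def)
      with \<open>zeros w \<subseteq> zeros w'\<close> have "zeros w \<subset> zeros w'" by blast
      then have "card (zeros w) < card (zeros w')"
        by (intro psubset_card_mono) (auto simp: zeros_def)
      ultimately show False using max by fastforce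
    qed
    have neg_z: "(- u) \<bullet> fst (y i) + (- b) = 0" if "i \<in> zeros w" for i
      using ub(2)[OF that] by simp
    consider "e * (u \<bullet> fst p + b) < 0" | "e * ((- u) \<bullet> fst p + (- b)) < 0" | "e * (u \<bullet> fst p + b) = 0"
      by (simp add: algebra_simps) linarith
    then show ?thesis
    proof cases
      case 1
      then have "conformal N s (\<lambda>i. u \<bullet> fst (y i) + b)"
        by (intro conformal_dir[OF ub(2)]) auto
      then show ?thesis using 1 unfolding s_def by blast
    next
      case 2
      then have "conformal N s (\<lambda>i. (- u) \<bullet> fst (y i) + (- b))"
        by (intro conformal_dir[OF neg_z]) auto
      then show ?thesis using 2 unfolding s_def by blast
    next
      case 3
      have "e * ((- u) \<bullet> fst p + (- b)) = - (e * (u \<bullet> fst p + b))"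
        by (simp add: algebra_simps)
      then have "conformal N s (\<lambda>i. (- u) \<bullet> fst (y i) + (- b))"
        using 3 by (intro conformal_dir[OF neg_z]) auto
      moreover have "conformal N s (\<lambda>i. u \<bullet> fst (y i) + b)"
        using 3 by (intro conformal_dir[OF ub(2)]) auto
      ultimately have "u \<bullet> fst (y i) + b = 0" if "i \<in> {1..N}" for i
      proof -
        have "0 \<le> s i * (u \<bullet> fst (y i) + b)" "0 \<le> s i * ((- u) \<bullet> fst (y i) + (- b))"
          "s i = 0 \<longrightarrow> u \<bullet> fst (y i) + b = 0"
          using \<open>conformal N s (\<lambda>i. u \<bullet> fst (y i) + b)\<close>
            \<open>conformal N s (\<lambda>i. (- u) \<bullet> fst (y i) + (- b))\<close> that
          unfolding conformal_def by blast+
        moreover have "s i * ((- u) \<bullet> fst (y i) + (- b)) = - (s i * (u \<bullet> fst (y i) + b))"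
          by (simp add: algebra_simps)
        ultimately have "s i * (u \<bullet> fst (y i) + b) = 0" by linarith
        then show ?thesis using \<open>s i = 0 \<longrightarrow> u \<bullet> fst (y i) + b = 0\<close> by fastforce
      qed
      then have "\<forall>i\<in>{1..N}. u \<bullet> (fst \<circ> y) i + b = 0" by simp
      then have "u = 0" using span unfolding spanning_def by blast
      then show ?thesis using ub(1) by simp
    qed
  qed
qed

text \<open>
  Adding a conforming value to a value of exact sign keeps the sign; this is how weak signs are turned
  back into exact ones.
\<close>

lemma conformal_combine:
  assumes conf: "conformal N (\<lambda>i. v \<bullet> y i + c) (\<lambda>i. v' \<bullet> z i + c')"
    and i: "i \<in> {1..N}" and pos: "0 < \<epsilon>" "0 \<le> \<mu>"
  shows "sgn (\<epsilon> * (v \<bullet> y i + c) + \<mu> * (v' \<bullet> z i + c')) = sgn (v \<bullet> y i + c)"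
proof -
  define f where "f = v \<bullet> y i + c"
  define g where "g = v' \<bullet> z i + c'"
  have fg: "0 \<le> f * g" "f = 0 \<longrightarrow> g = 0" using conf i unfolding conformal_def f_def g_def by auto
  consider "f = 0" | "f > 0" | "f < 0" by linarith
  then have "sgn (\<epsilon> * f + \<mu> * g) = sgn f"
  proof cases
    case 2
    then have "0 < \<epsilon> * f + \<mu> * g"
      using fg pos by (simp add: zero_le_mult_iff add_pos_nonneg)
    then show ?thesis using 2 by simp
  next
    case 3
    then have "g \<le> 0" using fg by (auto simp: zero_le_mult_iff)
    then have "\<epsilon> * f < 0" "\<mu> * g \<le> 0" using 3 pos by (auto simp: mult_pos_neg mult_nonneg_nonpos)
    then show ?thesis using 3 by simp
  qed (use fg in simp)
  then show ?thesis by (simp add: f_def g_def)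
qed

lemma lex_signed_mono: "lex_signed e n y \<Longrightarrow> m \<le> n \<Longrightarrow> lex_signed e m y"
  unfolding lex_signed_def by auto

lemma lex_signedD:
  fixes y :: "nat \<Rightarrow> 'a::euclidean_space \<times> real"
  assumes "lex_signed e (Suc N) y" "DIM('a) < N" "snd v = 1"
    and "spanned_hyperplane (y ` {1..N}) {q. v \<bullet> q + c = 0}"
  shows "0 < e (Suc N) * (v \<bullet> y (Suc N) + c)"
proof -
  have "{1..<Suc N} = {1..N}" by auto
  moreover have "Suc N \<in> {DIM('a) + 2..Suc N}" using assms(2) by simp
  ultimately show ?thesis using assms(1,3,4) unfolding lex_signed_def by metis
qed

text \<open>
  A functional can be moved to the prescribed side of the next point without changing its signs on the
  previous ones: a spanned conforming functional is on that side by the lex condition, and a small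
  multiple of the original one restores the exact signs.
\<close>

lemma lex_push:
  fixes y :: "nat \<Rightarrow> 'a::euclidean_space \<times> real"
  assumes span: "spanning {1..N} (fst \<circ> y)" and lex: "lex_signed e (Suc N) y" and N: "DIM('a) < N"
    and v: "snd v = 1"
  shows "\<exists>v' c'. snd v' = 1 \<and> (\<forall>i\<in>{1..N}. sgn (v' \<bullet> y i + c') = sgn (v \<bullet> y i + c)) \<and>
           0 < e (Suc N) * (v' \<bullet> y (Suc N) + c')"
proof -
  let ?E = "e (Suc N)" and ?p = "y (Suc N)"
  obtain v1 c1 where 1: "snd v1 = 1" "spanned_hyperplane (y ` {1..N}) {q. v1 \<bullet> q + c1 = 0}"
      "conformal N (\<lambda>i. v \<bullet> y i + c) (\<lambda>i. v1 \<bullet> y i + c1)"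
    using spanned_or_recession[OF span v, of 0 ?p c] by auto
  have pos: "0 < ?E * (v1 \<bullet> ?p + c1)"
    using lex_signedD[OF lex N 1(1,2)] .
  define K where "K = \<bar>?E * (v \<bullet> ?p + c)\<bar> + 1"
  \<comment> \<open>So small that adding \<open>\<epsilon>\<close> times the given functional lowers the value at the new point by less than half.\<close>
  define \<epsilon> where "\<epsilon> = ?E * (v1 \<bullet> ?p + c1) / (2 * K)"
  have K: "K > 0" "?E * (v \<bullet> ?p + c) > - K" by (auto simp: K_def)
  have \<epsilon>: "\<epsilon> > 0" using pos K by (simp add: \<epsilon>_def)
  \<comment> \<open>Rescales the last coefficient to 1.\<close>
  define \<alpha> where "\<alpha> = 1 / (1 + \<epsilon>)"
  have \<alpha>: "\<alpha> > 0" using \<epsilon> by (simp add: \<alpha>_def)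
  define v' where "v' = (\<alpha> * \<epsilon>) *\<^sub>R v + \<alpha> *\<^sub>R v1"
  define c' where "c' = (\<alpha> * \<epsilon>) * c + \<alpha> * c1"
  have val: "v' \<bullet> q + c' = (\<alpha> * \<epsilon>) * (v \<bullet> q + c) + \<alpha> * (v1 \<bullet> q + c1)" for q
    by (simp add: v'_def c'_def inner_add_left algebra_simps)
  have "snd v' = 1" using v 1(1) \<epsilon> by (simp add: v'_def \<alpha>_def field_simps)
  moreover have "sgn (v' \<bullet> y i + c') = sgn (v \<bullet> y i + c)" if "i \<in> {1..N}" for i
    unfolding val using conformal_combine[OF 1(3) that, of "\<alpha> * \<epsilon>" \<alpha>] \<alpha> \<epsilon> by simp
  moreover have "\<epsilon> * (?E * (v \<bullet> ?p + c)) + ?E * (v1 \<bullet> ?p + c1) > 0"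
  proof -
    have "\<epsilon> * (?E * (v \<bullet> ?p + c)) \<ge> \<epsilon> * (- K)" using K \<epsilon> by (intro mult_left_mono) auto
    moreover have "\<epsilon> * K = ?E * (v1 \<bullet> ?p + c1) / 2" using K by (simp add: \<epsilon>_def)
    ultimately show ?thesis using pos by linarith
  qed
  then have "0 < \<alpha> * (\<epsilon> * (?E * (v \<bullet> ?p + c)) + ?E * (v1 \<bullet> ?p + c1))" using \<alpha> by simp
  then have "0 < ?E * (v' \<bullet> ?p + c')" unfolding val by (simp add: algebra_simps)
  ultimately show ?thesis by blast
qed

text \<open>
  The spanned alternative of \<open>spanned_or_recession\<close> contradicts the lex condition, so the wrong side
  of the next point is reached only along a functional on the base.
\<close>

lemma lex_recession:
  fixes y :: "nat \<Rightarrow> 'a::euclidean_space \<times> real"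
  assumes span: "spanning {1..N} (fst \<circ> y)" and lex: "lex_signed e (Suc N) y" and N: "DIM('a) < N"
    and v: "snd v = 1" and neg: "e (Suc N) * (v \<bullet> y (Suc N) + c) \<le> 0"
  shows "\<exists>u b. conformal N (\<lambda>i. v \<bullet> y i + c) (\<lambda>i. u \<bullet> fst (y i) + b) \<and>
           e (Suc N) * (u \<bullet> fst (y (Suc N)) + b) < 0"
proof -
  have "\<not> e (Suc N) * (v' \<bullet> y (Suc N) + c') \<le> 0"
    if "snd v' = 1" "spanned_hyperplane (y ` {1..N}) {q. v' \<bullet> q + c' = 0}" for v' c'
    using lex_signedD[OF lex N that] by (simp add: not_le)
  then show ?thesis using spanned_or_recession[OF span v neg] by blast
qed

section \<open>Lex-liftings with equal height signs have equal covectors\<close>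

lemma covectors_cong: "(\<And>i. i \<in> {1..N} \<Longrightarrow> x i = x' i) \<Longrightarrow> covectors N x = covectors N x'"
  unfolding covectors_def by simp

lemma covectors_restrict:
  assumes "covectors n x = covectors n x'" "N \<le> n"
  shows "covectors N x \<subseteq> covectors N x'"
proof
  fix s assume "s \<in> covectors N x"
  then obtain v c where vc: "\<forall>i\<in>{1..N}. sgn (v \<bullet> x i + c) = s i" unfolding covectors_def by blast
  have "(\<lambda>i. sgn (v \<bullet> x i + c)) \<in> covectors n x"
    unfolding covectors_def by blast
  then have "(\<lambda>i. sgn (v \<bullet> x i + c)) \<in> covectors n x'"
    using assms(1) by simp
  then obtain v' c' where "\<forall>i\<in>{1..n}. sgn (v' \<bullet> x' i + c') = sgn (v \<bullet> x i + c)"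
    unfolding covectors_def by blast
  then have "\<forall>i\<in>{1..N}. sgn (v' \<bullet> x' i + c') = s i" using vc assms(2) by auto
  then show "s \<in> covectors N x'" unfolding covectors_def by blast
qed

lemma upper_covectorsI:
  assumes "snd v = 1" "\<And>i. i \<in> {1..N} \<Longrightarrow> sgn (v \<bullet> y i + c) = s i"
  shows "s \<in> upper_covectors N y"
  using assms unfolding upper_covectors_def by blast

lemma upper_interpolation:
  fixes y :: "nat \<Rightarrow> 'a::euclidean_space \<times> real"
  assumes "spanning {1..DIM('a) + 1} (fst \<circ> y)"
  shows "\<exists>v c. snd v = 1 \<and> (\<forall>i\<in>{1..DIM('a) + 1}. v \<bullet> y i + c = r i)"
proof -
  obtain u c where "\<forall>i\<in>{1..DIM('a) + 1}. u \<bullet> (fst \<circ> y) i + c = r i - snd (y i)"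
    using interpolation[OF _ _ assms] by fastforce
  then have "\<forall>i\<in>{1..DIM('a) + 1}. (u, 1) \<bullet> y i + c = r i"
    by (fastforce simp: inner_prod_def)
  then show ?thesis by (intro exI[of _ "(u, 1)"]) auto
qed

text \<open>
  Let a functional realize the sign vector on \<open>y\<close>. By hypothesis its first \<open>N\<close> signs are realized on
  \<open>y'\<close>, and by \<open>lex_push\<close> with the new point on its prescribed side. If the original functional has
  the new point on the other side or contains it, it provides a recession direction, whose signs are a
  covector of the base and can be copied to \<open>y'\<close>; moving along the copy gives the new point any
  value on that other side while the first \<open>N\<close> signs stay fixed.
\<close>

lemma upper_covectors_step:
  fixes y y' :: "nat \<Rightarrow> 'a::euclidean_space \<times> real"
  assumes span: "spanning {1..N} (fst \<circ> y)" "spanning {1..N} (fst \<circ> y')" and N: "DIM('a) < N"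
    and lex: "lex_signed e (Suc N) y" "lex_signed e (Suc N) y'"
    and base: "covectors (Suc N) (fst \<circ> y) \<subseteq> covectors (Suc N) (fst \<circ> y')"
    and IH: "upper_covectors N y \<subseteq> upper_covectors N y'"
  shows "upper_covectors (Suc N) y \<subseteq> upper_covectors (Suc N) y'"
proof
  let ?E = "e (Suc N)"
  fix s assume "s \<in> upper_covectors (Suc N) y"
  then obtain v c where v: "snd v = 1" and s: "\<forall>i\<in>{1..Suc N}. sgn (v \<bullet> y i + c) = s i"
    unfolding upper_covectors_def by blast
  from s have "\<forall>i\<in>{1..N}. sgn (v \<bullet> y i + c) = s i" by simp
  then have "s \<in> upper_covectors N y" using v unfolding upper_covectors_def by blast
  then have "s \<in> upper_covectors N y'" using IH by blast
  then obtain v0 c0 where v0: "snd v0 = 1" "\<forall>i\<in>{1..N}. sgn (v0 \<bullet> y' i + c0) = s i"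
    unfolding upper_covectors_def by blast
  obtain v1 c1 where v1: "snd v1 = 1" "\<forall>i\<in>{1..N}. sgn (v1 \<bullet> y' i + c1) = s i"
      "0 < ?E * (v1 \<bullet> y' (Suc N) + c1)"
    using lex_push[OF span(2) lex(2) N v0(1), of c0] v0(2) by auto
  have sN: "sgn (v \<bullet> y (Suc N) + c) = s (Suc N)" using s by simp
  have split: "{1..Suc N} = insert (Suc N) {1..N}" by auto
  show "s \<in> upper_covectors (Suc N) y'"
  proof (cases "?E * (v \<bullet> y (Suc N) + c) \<le> 0")
    case False
    then have "sgn (v1 \<bullet> y' (Suc N) + c1) = s (Suc N)"
      using v1(3) sN by (auto simp: zero_less_mult_iff not_le sgn_if split: if_splits)
    then show ?thesis 
      using v1(2) by (intro upper_covectorsI[OF v1(1), of _ _ c1]) (auto simp: le_Suc_eq)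
  next
    case True
    obtain u b where u: "conformal N (\<lambda>i. v \<bullet> y i + c) (\<lambda>i. u \<bullet> fst (y i) + b)"
        "?E * (u \<bullet> fst (y (Suc N)) + b) < 0"
      using lex_recession[OF span(1) lex(1) N v True] by blast
    have "(\<lambda>i. sgn (u \<bullet> (fst \<circ> y) i + b)) \<in> covectors (Suc N) (fst \<circ> y)"
      unfolding covectors_def by blast
    then have "(\<lambda>i. sgn (u \<bullet> (fst \<circ> y) i + b)) \<in> covectors (Suc N) (fst \<circ> y')"
      using base by blast
    then obtain u' b' where u': "\<forall>i\<in>{1..Suc N}. sgn (u' \<bullet> fst (y' i) + b') = sgn (u \<bullet> fst (y i) + b)"
      unfolding covectors_def by auto
    have conf: "conformal N (\<lambda>i. v1 \<bullet> y' i + c1) (\<lambda>i. u' \<bullet> fst (y' i) + b')"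
      unfolding conformal_def
    proof
      fix i assume i: "i \<in> {1..N}"
      have sg: "sgn (v1 \<bullet> y' i + c1) = sgn (v \<bullet> y i + c)"
        "sgn (u' \<bullet> fst (y' i) + b') = sgn (u \<bullet> fst (y i) + b)"
        using i v1(2) s u' by auto
      have "0 \<le> (v \<bullet> y i + c) * (u \<bullet> fst (y i) + b) \<and> (v \<bullet> y i + c = 0 \<longrightarrow> u \<bullet> fst (y i) + b = 0)"
        using u(1) i unfolding conformal_def by auto
      then show "0 \<le> (v1 \<bullet> y' i + c1) * (u' \<bullet> fst (y' i) + b') \<and>
          (v1 \<bullet> y' i + c1 = 0 \<longrightarrow> u' \<bullet> fst (y' i) + b' = 0)"
        using sg by (auto simp: sgn_if zero_le_mult_iff split: if_splits)
    qed
    have neg: "?E * (u' \<bullet> fst (y' (Suc N)) + b') < 0"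
    proof -
      have "sgn (u' \<bullet> fst (y' (Suc N)) + b') = sgn (u \<bullet> fst (y (Suc N)) + b)" using u' by simp
      then show ?thesis
        using u(2) by (auto simp: sgn_if mult_less_0_iff split: if_splits)
    qed
    define f where "f = v1 \<bullet> y' (Suc N) + c1"
    define g where "g = u' \<bullet> fst (y' (Suc N)) + b'"
    define target where "target = v \<bullet> y (Suc N) + c"
    \<comment> \<open>The step length that gives the new point of the copy the value that the old functional has at its new point.\<close>
    define \<mu> where "\<mu> = (target - f) / g"
    have E: "?E \<noteq> 0" using v1(3) by auto
    have fg: "0 < ?E * f" "?E * g < 0" "?E * target \<le> 0"
      using v1(3) neg True by (simp_all add: f_def g_def target_def)
    have "?E * (target - f) \<le> 0" using fg by (simp add: algebra_simps)
    then have "0 \<le> (?E * (target - f)) / (?E * g)"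
      using fg(2) by (rule divide_nonpos_neg)
    then have \<mu>: "0 \<le> \<mu>" using E by (simp add: \<mu>_def)
    have "g \<noteq> 0" using fg by auto
    then have hit: "f + \<mu> * g = target" by (simp add: \<mu>_def)
    define w where "w = v1 + (\<mu> *\<^sub>R u', 0)"
    define d where "d = c1 + \<mu> * b'"
    have val: "w \<bullet> q + d = 1 * (v1 \<bullet> q + c1) + \<mu> * (u' \<bullet> fst q + b')" for q
      by (simp add: w_def d_def inner_prod_def algebra_simps)
    have "sgn (w \<bullet> y' i + d) = s i" if "i \<in> {1..N}" for i
      unfolding val using conformal_combine[OF conf that, of 1 \<mu>] \<mu> v1(2) that by simp
    moreover have "sgn (w \<bullet> y' (Suc N) + d) = s (Suc N)"
      unfolding val using hit sN by (simp add: f_def g_def target_def)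
    moreover have "snd w = 1" using v1 by (simp add: w_def)
    ultimately show ?thesis unfolding upper_covectors_def split by blast
  qed
qed

lemma upper_covectors_subset:
  fixes y y' :: "nat \<Rightarrow> 'a::euclidean_space \<times> real"
  assumes span: "spanning {1..DIM('a) + 1} (fst \<circ> y)" "spanning {1..DIM('a) + 1} (fst \<circ> y')"
    and lex: "lex_signed e n y" "lex_signed e n y'"
    and cov: "covectors n (fst \<circ> y) = covectors n (fst \<circ> y')" and n: "DIM('a) + 1 \<le> n"
  shows "upper_covectors n y \<subseteq> upper_covectors n y'"
proof -
  have "N \<le> n \<longrightarrow> upper_covectors N y \<subseteq> upper_covectors N y'" if "DIM('a) + 1 \<le> N" for N
    using that
  proof (induction N rule: dec_induct)
    case base
    show ?case
    proof (intro impI subsetI)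
      fix s assume s: "s \<in> upper_covectors (DIM('a) + 1) y"
      obtain v c where "snd v = 1" "\<forall>i\<in>{1..DIM('a) + 1}. v \<bullet> y' i + c = s i"
        using upper_interpolation[OF span(2)] by blast
      moreover have "\<forall>i\<in>{1..DIM('a) + 1}. sgn (s i) = s i"
      proof -
        obtain v0 c0 where "\<forall>i\<in>{1..DIM('a) + 1}. sgn (v0 \<bullet> y i + c0) = s i"
          using s unfolding upper_covectors_def by blast
        then show ?thesis by (metis sgn_sgn)
      qed
      ultimately show "s \<in> upper_covectors (DIM('a) + 1) y'" 
        by (intro upper_covectorsI[of v _ _ c]) auto
    qed
  next
    case (step N)
    show ?case
    proof
      assume N: "Suc N \<le> n"
      show "upper_covectors (Suc N) y \<subseteq> upper_covectors (Suc N) y'"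
      proof (rule upper_covectors_step)
        show "spanning {1..N} (fst \<circ> y)" "spanning {1..N} (fst \<circ> y')"
          using span step.hyps by (auto intro: spanning_mono)
        show "lex_signed e (Suc N) y" "lex_signed e (Suc N) y'" using lex N lex_signed_mono by blast+
        show "covectors (Suc N) (fst \<circ> y) \<subseteq> covectors (Suc N) (fst \<circ> y')"
          using covectors_restrict[OF cov N] .
      qed (use step N in auto)
    qed
  qed
  then show ?thesis using n by blast
qed

text \<open>
  A functional is vertical, hence lives on the base, or becomes one with last coefficient \<open>1\<close> after
  division by its last coefficient, which flips all signs if that coefficient is negative.
\<close>

lemma covectors_lift_subset:
  fixes y y' :: "nat \<Rightarrow> 'a::euclidean_space \<times> real"
  assumes cov: "covectors n (fst \<circ> y) = covectors n (fst \<circ> y')"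
    and up: "upper_covectors n y \<subseteq> upper_covectors n y'"
  shows "covectors n y \<subseteq> covectors n y'"
proof
  fix s assume "s \<in> covectors n y"
  then obtain v c where vc: "\<forall>i\<in>{1..n}. sgn (v \<bullet> y i + c) = s i" unfolding covectors_def by blast
  show "s \<in> covectors n y'"
  proof (cases "snd v = 0")
    case True
    then have "\<forall>i\<in>{1..n}. sgn (fst v \<bullet> (fst \<circ> y) i + c) = s i"
      using vc by (simp add: inner_prod_def)
    then have "s \<in> covectors n (fst \<circ> y)" unfolding covectors_def by blast
    then have "s \<in> covectors n (fst \<circ> y')" by (simp add: cov)
    then obtain u b where "\<forall>i\<in>{1..n}. sgn (u \<bullet> (fst \<circ> y') i + b) = s i"
      unfolding covectors_def by blast
    then have "\<forall>i\<in>{1..n}. sgn ((u, 0) \<bullet> y' i + b) = s i" by (simp add: inner_prod_def)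
    then show ?thesis unfolding covectors_def by blast
  next
    case False
    define \<sigma> where "\<sigma> = snd v"
    have \<sigma>: "\<sigma> \<noteq> 0" using False by (simp add: \<sigma>_def)
    have "sgn (((1 / \<sigma>) *\<^sub>R v) \<bullet> y i + c / \<sigma>) = sgn \<sigma> * s i" if "i \<in> {1..n}" for i
    proof -
      have "((1 / \<sigma>) *\<^sub>R v) \<bullet> y i + c / \<sigma> = (v \<bullet> y i + c) / \<sigma>" by (simp add: add_divide_distrib)
      moreover have "sgn ((v \<bullet> y i + c) / \<sigma>) = sgn \<sigma> * sgn (v \<bullet> y i + c)"
        using \<sigma> by (auto simp: sgn_if zero_less_divide_iff)
      ultimately show ?thesis using vc that by simp
    qed
    moreover have "snd ((1 / \<sigma>) *\<^sub>R v) = 1" using \<sigma> by (simp add: \<sigma>_def)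
    ultimately have "(\<lambda>i. sgn \<sigma> * s i) \<in> upper_covectors n y" unfolding upper_covectors_def by blast
    then have "(\<lambda>i. sgn \<sigma> * s i) \<in> upper_covectors n y'" using up by blast
    then obtain w d where w: "\<forall>i\<in>{1..n}. sgn (w \<bullet> y' i + d) = sgn \<sigma> * s i"
      unfolding upper_covectors_def by blast
    have "sgn ((\<sigma> *\<^sub>R w) \<bullet> y' i + \<sigma> * d) = s i" if "i \<in> {1..n}" for i
    proof -
      have "(\<sigma> *\<^sub>R w) \<bullet> y' i + \<sigma> * d = \<sigma> * (w \<bullet> y' i + d)" by (simp add: algebra_simps)
      then have "sgn ((\<sigma> *\<^sub>R w) \<bullet> y' i + \<sigma> * d) = sgn \<sigma> * (sgn \<sigma> * s i)"
        using w that by (simp add: sgn_mult)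
      then show ?thesis using \<sigma> by (auto simp: sgn_if)
    qed
    then show ?thesis unfolding covectors_def by blast
  qed
qed

lemma covectors_lex_lift:
  fixes y y' :: "nat \<Rightarrow> 'a::euclidean_space \<times> real"
  assumes "spanning {1..DIM('a) + 1} (fst \<circ> y)" "spanning {1..DIM('a) + 1} (fst \<circ> y')"
    and "lex_signed e n y" "lex_signed e n y'"
    and "covectors n (fst \<circ> y) = covectors n (fst \<circ> y')" and "DIM('a) + 1 \<le> n"
  shows "covectors n y = covectors n y'"
proof
  show "covectors n y \<subseteq> covectors n y'"
    using assms by (intro covectors_lift_subset upper_covectors_subset) auto
  show "covectors n y' \<subseteq> covectors n y"
    using assms by (intro covectors_lift_subset upper_covectors_subset) auto
qed

text \<open>
  A graph hyperplane through the first \<open>DIM('a) + 1\<close> lifted points is unique, so the lex condition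
  keeps the next point off it. Formally, the recession direction that a hyperplane through all the
  points would provide vanishes on a spanning set, hence everywhere.
\<close>

lemma spanning_lex_lift:
  fixes y :: "nat \<Rightarrow> 'a::euclidean_space \<times> real"
  assumes span: "spanning {1..DIM('a) + 1} (fst \<circ> y)" and lex: "lex_signed e (DIM('a) + 2) y"
  shows "spanning {1..DIM('a) + 2} y"
  unfolding spanning_def
proof (intro allI impI)
  fix V c assume V: "\<forall>i\<in>{1..DIM('a) + 2}. V \<bullet> y i + c = 0"
  show "V = 0"
  proof (cases "snd V = 0")
    case True
    then have "\<forall>i\<in>{1..DIM('a) + 1}. fst V \<bullet> (fst \<circ> y) i + c = 0"
      using V by (auto simp: inner_prod_def)
    then have "fst V = 0" using span unfolding spanning_def by blast
    then show ?thesis using True by (simp add: prod_eq_iff)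
  next
    case False
    let ?N = "DIM('a) + 1"
    define v where "v = (1 / snd V) *\<^sub>R V"
    define d where "d = c / snd V"
    have val: "v \<bullet> q + d = (V \<bullet> q + c) / snd V" for q by (simp add: v_def d_def add_divide_distrib)
    have zero: "v \<bullet> y i + d = 0" if "i \<in> {1..Suc ?N}" for i
      unfolding val using V that by simp
    have v: "snd v = 1" using False by (simp add: v_def)
    obtain u b where "e (Suc ?N) * (u \<bullet> fst (y (Suc ?N)) + b) < 0"
      "conformal ?N (\<lambda>i. v \<bullet> y i + d) (\<lambda>i. u \<bullet> fst (y i) + b)"
      using lex_recession[OF span _ _ v, of e d] lex zero by auto
    moreover from this have u0: "\<forall>i\<in>{1..?N}. u \<bullet> (fst \<circ> y) i + b = 0"
      using zero unfolding conformal_def by auto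
    then have "u = 0" using span unfolding spanning_def by blast
    moreover from u0 have "b = 0" using \<open>u = 0\<close> by auto
    ultimately show ?thesis by simp
  qed
qed

section \<open>Faces as nonnegative covectors\<close>

definition face_sign :: "nat set \<Rightarrow> nat \<Rightarrow> real" where
  "face_sign I = (\<lambda>i. if i \<in> I then 0 else 1)"

lemma sgn_eq_face_sign: "sgn t = face_sign I i \<longleftrightarrow> 0 \<le> t \<and> (t = 0 \<longleftrightarrow> i \<in> I)"
  by (auto simp: face_sign_def sgn_if)

lemma face_sign_covectors_iff:
  "face_sign I \<in> covectors n y \<longleftrightarrow>
     (\<exists>v c. \<forall>i\<in>{1..n}. 0 \<le> v \<bullet> y i + c \<and> (v \<bullet> y i + c = 0 \<longleftrightarrow> i \<in> I))"
  unfolding covectors_def mem_Collect_eq sgn_eq_face_sign ..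

lemma vertices_supported_face:
  fixes P :: "'a::euclidean_space set"
  assumes "convex P" "P \<subseteq> {q. 0 \<le> v \<bullet> q + c}"
  shows "P \<inter> {q. v \<bullet> q + c = 0} face_of P"
    and "vertices (P \<inter> {q. v \<bullet> q + c = 0}) = {q \<in> vertices P. v \<bullet> q + c = 0}"
proof -
  have eq: "{q. v \<bullet> q + c = 0} = {q. v \<bullet> q = - c}" by auto
  show face: "P \<inter> {q. v \<bullet> q + c = 0} face_of P"
    unfolding eq using assms by (intro face_of_Int_supporting_hyperplane_ge) (auto simp: algebra_simps)
  show "vertices (P \<inter> {q. v \<bullet> q + c = 0}) = {q \<in> vertices P. v \<bullet> q + c = 0}"
    unfolding vertices_def extreme_point_of_face[OF face] by (auto simp: extreme_point_of_def)
qed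

lemma hull_nonneg:
  assumes "\<forall>i\<in>{1..n}. 0 \<le> v \<bullet> y i + c"
  shows "convex hull (y ` {1..n}) \<subseteq> {q. 0 \<le> v \<bullet> q + c}"
proof (rule hull_minimal)
  have "{q. 0 \<le> v \<bullet> q + c} = {q. v \<bullet> q \<ge> - c}" by auto
  then show "convex {q. 0 \<le> v \<bullet> q + c}" by (simp add: convex_halfspace_ge)
qed (use assms in auto)

lemma polytope_hull_image: "polytope (convex hull (y ` {1..n::nat}))"
  unfolding polytope_def by blast

text \<open>
  The supported face whose only labeled point is \<open>y i\<close> is the convex hull of its vertices, which are
  labeled points, so it is the single point \<open>y i\<close>.
\<close>

lemma vertex_labelingI:
  fixes y :: "nat \<Rightarrow> 'a::euclidean_space"
  assumes "\<And>i. i \<in> {1..n} \<Longrightarrow> face_sign {i} \<in> covectors n y"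
  shows "vertex_labeling n y (convex hull (y ` {1..n}))"
proof -
  let ?P = "convex hull (y ` {1..n})"
  have supp: "\<exists>v c. \<forall>j\<in>{1..n}. 0 \<le> v \<bullet> y j + c \<and> (v \<bullet> y j + c = 0 \<longleftrightarrow> j = i)"
    if "i \<in> {1..n}" for i
    using assms[OF that] unfolding face_sign_covectors_iff by simp
  have "inj_on y {1..n}" by (intro inj_onI) (metis supp)
  moreover have "y i \<in> vertices ?P" if i: "i \<in> {1..n}" for i
  proof -
    obtain v c where vc: "\<forall>j\<in>{1..n}. 0 \<le> v \<bullet> y j + c \<and> (v \<bullet> y j + c = 0 \<longleftrightarrow> j = i)"
      using supp[OF i] by blast
    let ?F = "?P \<inter> {q. v \<bullet> q + c = 0}"
    have sub: "?P \<subseteq> {q. 0 \<le> v \<bullet> q + c}" using hull_nonneg vc by blast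
    note F = vertices_supported_face[OF convex_convex_hull sub]
    have "vertices ?P \<subseteq> y ` {1..n}"
      unfolding vertices_def using extreme_point_of_convex_hull by blast
    then have "vertices ?F \<subseteq> {y i}" unfolding F(2) using vc by auto
    moreover have "polytope ?F"
      using face_of_polytope_polytope[OF polytope_hull_image F(1)] .
    then have "?F = convex hull (vertices ?F)"
      unfolding vertices_def
      using Krein_Milman_Minkowski polytope_imp_compact polytope_imp_convex by blast
    moreover have "y i \<in> ?F" using vc i by (auto intro: hull_inc)
    ultimately have "vertices ?F = {y i}"
      by (metis convex_hull_empty empty_iff subset_singletonD)
    then show ?thesis unfolding F(2) by blast
  qed
  moreover have "vertices ?P \<subseteq> y ` {1..n}"
    unfolding vertices_def using extreme_point_of_convex_hull by blast
  ultimately show ?thesis unfolding vertex_labeling_def bij_betw_def by blast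
qed

text \<open>
  Faces of a polytope are exposed. The improper faces are covered as well, by the functionals that
  are constantly \<open>0\<close> and constantly \<open>1\<close>.
\<close>

lemma face_lattice_covectors:
  fixes y :: "nat \<Rightarrow> 'a::euclidean_space"
  assumes lab: "vertex_labeling n y P" and P: "P = convex hull (y ` {1..n})"
  shows "face_lattice n y P = {I. I \<subseteq> {1..n} \<and> face_sign I \<in> covectors n y}"
proof -
  have vert: "vertices P = y ` {1..n}" and inj: "inj_on y {1..n}"
    using lab unfolding vertex_labeling_def bij_betw_def by auto
  have poly: "polytope P" unfolding P by (rule polytope_hull_image)
  have "(\<exists>F. F face_of P \<and> vertices F = y ` I) \<longleftrightarrow> face_sign I \<in> covectors n y"
    if I: "I \<subseteq> {1..n}" for I
  proof
    assume "face_sign I \<in> covectors n y"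
    then obtain v c where vc: "\<forall>i\<in>{1..n}. 0 \<le> v \<bullet> y i + c \<and> (v \<bullet> y i + c = 0 \<longleftrightarrow> i \<in> I)"
      unfolding face_sign_covectors_iff by blast
    then have "P \<subseteq> {q. 0 \<le> v \<bullet> q + c}" unfolding P using hull_nonneg by blast
    note F = vertices_supported_face[OF polytope_imp_convex[OF poly] this]
    have "{q \<in> vertices P. v \<bullet> q + c = 0} = y ` I" unfolding vert using vc I by auto
    then show "\<exists>F. F face_of P \<and> vertices F = y ` I" using F by auto
  next
    assume "\<exists>F. F face_of P \<and> vertices F = y ` I"
    then obtain F where F: "F face_of P" "vertices F = y ` I" by blast
    have "F exposed_face_of P"
      using F(1) poly exposed_face_of_polyhedron polytope_imp_polyhedron by blast
    then obtain a b where ab: "P \<subseteq> {q. a \<bullet> q \<le> b}" "F = P \<inter> {q. a \<bullet> q = b}"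
      unfolding exposed_face_of_def by blast
    have le: "a \<bullet> y i \<le> b" if "i \<in> {1..n}" for i
      using ab(1) that unfolding P by (meson hull_inc imageI mem_Collect_eq subsetD)
    have sub: "P \<subseteq> {q. 0 \<le> (- a) \<bullet> q + b}" using ab(1) by auto
    have "F = P \<inter> {q. (- a) \<bullet> q + b = 0}" using ab(2) by auto
    then have "y ` I = {q \<in> vertices P. (- a) \<bullet> q + b = 0}"
      using vertices_supported_face(2)[OF polytope_imp_convex[OF poly] sub] F(2) by simp
    then have "y i \<in> y ` I \<longleftrightarrow> (- a) \<bullet> y i + b = 0" if "i \<in> {1..n}" for i
      using that unfolding vert by blast
    moreover have "y i \<in> y ` I \<longleftrightarrow> i \<in> I" if "i \<in> {1..n}" for i
      using that inj I by (meson inj_on_image_mem_iff)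
    ultimately have "\<forall>i\<in>{1..n}. 0 \<le> (- a) \<bullet> y i + b \<and> ((- a) \<bullet> y i + b = 0 \<longleftrightarrow> i \<in> I)"
      using le by auto
    then show "face_sign I \<in> covectors n y" unfolding face_sign_covectors_iff by blast
  qed
  then show ?thesis unfolding face_lattice_def by blast
qed

lemma covectors_mono: "s \<in> covectors n y \<Longrightarrow> N \<le> n \<Longrightarrow> s \<in> covectors N y"
  unfolding covectors_def by (clarsimp, metis atLeastAtMost_iff order_trans)

lemma face_sign_Int:
  assumes "face_sign I \<in> covectors n y" "face_sign J \<in> covectors n y"
  shows "face_sign (I \<inter> J) \<in> covectors n y"
proof -
  obtain v c where vc: "\<forall>i\<in>{1..n}. 0 \<le> v \<bullet> y i + c \<and> (v \<bullet> y i + c = 0 \<longleftrightarrow> i \<in> I)"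
    using assms(1) unfolding face_sign_covectors_iff by blast
  obtain w d where wd: "\<forall>i\<in>{1..n}. 0 \<le> w \<bullet> y i + d \<and> (w \<bullet> y i + d = 0 \<longleftrightarrow> i \<in> J)"
    using assms(2) unfolding face_sign_covectors_iff by blast
  have "0 \<le> (v + w) \<bullet> y i + (c + d) \<and> ((v + w) \<bullet> y i + (c + d) = 0 \<longleftrightarrow> i \<in> I \<inter> J)"
    if "i \<in> {1..n}" for i
  proof -
    have "(v + w) \<bullet> y i + (c + d) = (v \<bullet> y i + c) + (w \<bullet> y i + d)" by (simp add: inner_add_left)
    moreover have "0 \<le> v \<bullet> y i + c \<and> (v \<bullet> y i + c = 0 \<longleftrightarrow> i \<in> I)"
      "0 \<le> w \<bullet> y i + d \<and> (w \<bullet> y i + d = 0 \<longleftrightarrow> i \<in> J)"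
      using vc wd that by blast+
    ultimately show ?thesis by (metis Int_iff add_nonneg_eq_0_iff add_nonneg_nonneg)
  qed
  then show ?thesis unfolding face_sign_covectors_iff by blast
qed

text \<open>
  A set with fewer than \<open>k\<close> labels is the intersection of two sets with one label more, and the sum
  of the functionals supporting these supports the intersection.
\<close>

lemma face_sign_small_sets:
  assumes faces: "\<And>S. S \<subseteq> {1..n} \<Longrightarrow> card S = k \<Longrightarrow> face_sign S \<in> covectors n y"
    and "k < n" "S \<subseteq> {1..n}" "card S \<le> k"
  shows "face_sign S \<in> covectors n y"
  using assms(3,4)
proof (induction "k - card S" arbitrary: S)
  case 0
  then show ?case using faces by simp
next
  case (Suc m)
  have fin: "finite S" using Suc.prems finite_subset by blast
  \<comment> \<open>Two labels outside S exist because card S < k < n.\<close>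
  have "card ({1..n} - S) = n - card S" using Suc.prems fin by (simp add: card_Diff_subset)
  then have "2 \<le> card ({1..n} - S)" using Suc.hyps(2) assms(2) by linarith
  then obtain T where "T \<subseteq> {1..n} - S" "card T = 2" by (meson obtain_subset_with_card_n)
  then obtain a b where ab: "a \<noteq> b" "a \<in> {1..n} - S" "b \<in> {1..n} - S"
    by (auto simp: card_2_iff)
  have "face_sign (insert a S) \<in> covectors n y" "face_sign (insert b S) \<in> covectors n y"
    using Suc fin ab by (auto intro!: Suc.hyps(1))
  then have "face_sign (insert a S \<inter> insert b S) \<in> covectors n y" by (rule face_sign_Int)
  moreover have "insert a S \<inter> insert b S = S" using ab by auto
  ultimately show ?case by simp
qed

section \<open>Neighborliness of the double lifting\<close>

lemma finite_domination:
  fixes g h :: "nat \<Rightarrow> real"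
  assumes "finite I" "\<And>i. i \<in> I \<Longrightarrow> 0 < h i"
  shows "\<exists>\<mu>. \<forall>i\<in>I. \<bar>g i\<bar> < \<mu> * h i"
proof (intro exI ballI)
  fix i assume i: "i \<in> I"
  have "\<bar>g i\<bar> / h i \<le> (\<Sum>j\<in>I. \<bar>g j\<bar> / h j)"
    using assms i by (intro member_le_sum) (auto intro: divide_nonneg_pos)
  then have "\<bar>g i\<bar> / h i < (\<Sum>j\<in>I. \<bar>g j\<bar> / h j) + 1" by simp
  then show "\<bar>g i\<bar> < ((\<Sum>j\<in>I. \<bar>g j\<bar> / h j) + 1) * h i"
    using assms(2)[OF i] by (simp add: pos_divide_less_eq)
qed

text \<open>
  A face of the base is, with its heights interpolated by an affine function, a face of both the upper
  and the lower hull of the lift: add a large multiple of the functional that supports it in the base,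
  with either sign. The new point sees the upper hull if it was lifted up and the lower hull if it was
  lifted down.
\<close>

lemma lift_face_visible:
  fixes z :: "nat \<Rightarrow> 'a::euclidean_space \<times> real"
  assumes span: "spanning {1..N} (fst \<circ> z)" and lex: "lex_signed e (Suc N) z" and N: "DIM('a) < N"
    and face: "face_sign S \<in> covectors N (fst \<circ> z)"
    and J: "S \<subseteq> J" "finite J" "card J = DIM('a) + 1" "spanning J (fst \<circ> z)"
  shows "\<exists>w d. (\<forall>i\<in>{1..N}. sgn (w \<bullet> z i + d) = face_sign S i) \<and> w \<bullet> z (Suc N) + d < 0"
proof -
  let ?E = "e (Suc N)"
  define \<sigma> where "\<sigma> = sgn ?E"
  obtain u b where "\<forall>i\<in>{1..N}. sgn (u \<bullet> (fst \<circ> z) i + b) = face_sign S i"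
    using face unfolding covectors_def by blast
  then have u: "0 \<le> u \<bullet> fst (z i) + b \<and> (u \<bullet> fst (z i) + b = 0 \<longleftrightarrow> i \<in> S)" if "i \<in> {1..N}" for i
    using that unfolding sgn_eq_face_sign by simp
  \<comment> \<open>The functional (q, 1) with offset r vanishes on the lifted face, with arbitrary signs elsewhere.\<close>
  obtain q r where "\<forall>i\<in>J. q \<bullet> (fst \<circ> z) i + r = - snd (z i)"
    using interpolation[OF J(2-4), of "\<lambda>i. - snd (z i)"] by blast
  then have q: "(q, 1) \<bullet> z i + r = 0" if "i \<in> J" for i using that by (fastforce simp: inner_prod_def)
  have "0 < u \<bullet> fst (z i) + b" if "i \<in> {1..N} - S" for i
    using u[of i] that by (auto simp: order_less_le)
  then obtain \<mu> where \<mu>: "\<forall>i\<in>{1..N} - S. \<bar>(q, 1) \<bullet> z i + r\<bar> < \<mu> * (u \<bullet> fst (z i) + b)"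
    using finite_domination[of "{1..N} - S" "\<lambda>i. u \<bullet> fst (z i) + b" "\<lambda>i. (q, 1) \<bullet> z i + r"] by auto
  \<comment> \<open>Subtracting \<open>\<sigma> * \<mu>\<close> times the base functional gives all points outside S the sign \<open>- \<sigma>\<close>.\<close>
  define v where "v = (q - (\<sigma> * \<mu>) *\<^sub>R u, 1::real)"
  define c where "c = r - \<sigma> * \<mu> * b"
  have val: "v \<bullet> p + c = ((q, 1) \<bullet> p + r) - \<sigma> * (\<mu> * (u \<bullet> fst p + b))" for p
    by (simp add: v_def c_def inner_prod_def algebra_simps)
  obtain v' c' where v': "\<forall>i\<in>{1..N}. sgn (v' \<bullet> z i + c') = sgn (v \<bullet> z i + c)"
      "0 < ?E * (v' \<bullet> z (Suc N) + c')"
    using lex_push[OF span lex N, of v c] by (auto simp: v_def)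
  have \<sigma>: "\<sigma> = 1 \<or> \<sigma> = -1" using v'(2) by (auto simp: \<sigma>_def sgn_if)
  have "sgn (((- \<sigma>) *\<^sub>R v') \<bullet> z i + (- \<sigma>) * c') = face_sign S i" if i: "i \<in> {1..N}" for i
  proof -
    have "sgn (((- \<sigma>) *\<^sub>R v') \<bullet> z i + (- \<sigma>) * c') = sgn (- \<sigma> * (v' \<bullet> z i + c'))"
      by (simp add: algebra_simps)
    also have "\<dots> = sgn (- \<sigma>) * sgn (v \<bullet> z i + c)" using v'(1) i by (simp add: sgn_mult)
    also have "\<dots> = face_sign S i"
    proof (cases "i \<in> S")
      case True
      then have "v \<bullet> z i + c = 0" unfolding val using q J(1) u[OF i] by auto
      then show ?thesis using True by (simp add: face_sign_def)
    next
      case False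
      then have "\<bar>(q, 1) \<bullet> z i + r\<bar> < \<mu> * (u \<bullet> fst (z i) + b)" using \<mu> i by blast
      then show ?thesis unfolding val using \<sigma> False by (auto simp: face_sign_def sgn_if)
    qed
    finally show ?thesis .
  qed
  moreover have "((- \<sigma>) *\<^sub>R v') \<bullet> z (Suc N) + (- \<sigma>) * c' < 0"
  proof -
    have "((- \<sigma>) *\<^sub>R v') \<bullet> z (Suc N) + (- \<sigma>) * c' = - (\<sigma> * (v' \<bullet> z (Suc N) + c'))"
      by (simp add: algebra_simps)
    moreover have "0 < \<sigma> * (v' \<bullet> z (Suc N) + c')"
      using v'(2) by (auto simp: \<sigma>_def sgn_if zero_less_mult_iff)
    ultimately show ?thesis by simp
  qed
  ultimately show ?thesis by blast
qed

text \<open>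
  The induction over the points treats all sets of at most \<open>k + 1\<close> labels at once, because a set
  containing the new label needs a supporting functional of the remaining labels, which are fewer. The
  induction starts with \<open>DIM('a) + 2\<close> points, which are affinely independent already before the
  second lifting.
\<close>

lemma double_lift_lower_faces:
  fixes y :: "nat \<Rightarrow> ('a::euclidean_space \<times> real) \<times> real"
  assumes gen: "\<And>J. J \<subseteq> {1..n} \<Longrightarrow> card J = DIM('a) + 1 \<Longrightarrow> spanning J (fst \<circ> (fst \<circ> y))"
    and lex1: "lex_signed e n (fst \<circ> y)" and lex2: "lex_signed (\<lambda>_. 1) n y"
    and faces: "\<And>S. S \<subseteq> {1..n} \<Longrightarrow> card S \<le> k \<Longrightarrow> face_sign S \<in> covectors n (fst \<circ> (fst \<circ> y))"
    and k: "k \<le> DIM('a)" and n: "DIM('a) + 2 \<le> n"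
    and S: "S \<subseteq> {1..n}" "card S \<le> k + 1"
  shows "face_sign S \<in> upper_covectors n y"
proof -
  have span0: "spanning {1..DIM('a) + 1} (fst \<circ> (fst \<circ> y))"
    using n by (intro gen) auto
  have span1: "spanning {1..DIM('a) + 2} (fst \<circ> y)"
    by (rule spanning_lex_lift[OF span0 lex_signed_mono[OF lex1 n]])
  have "N \<le> n \<longrightarrow> (\<forall>S \<subseteq> {1..N}. card S \<le> k + 1 \<longrightarrow> face_sign S \<in> upper_covectors N y)"
    if "DIM('a) + 2 \<le> N" for N
    using that
  proof (induction N rule: dec_induct)
    case base
    have "face_sign S \<in> upper_covectors (DIM('a) + 2) y" for S
    proof -
      obtain v c where "snd v = 1" "\<forall>i\<in>{1..DIM('a) + 2}. v \<bullet> y i + c = face_sign S i"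
        using upper_interpolation[of y "face_sign S"] span1 by auto
      then show ?thesis by (intro upper_covectorsI[of v _ _ c]) (auto simp: face_sign_def)
    qed
    then show ?case by blast
  next
    case (step N)
    show ?case
    proof (intro impI allI)
      fix S assume N: "Suc N \<le> n" and S: "S \<subseteq> {1..Suc N}" "card S \<le> k + 1"
      have IH: "face_sign S' \<in> upper_covectors N y" if "S' \<subseteq> {1..N}" "card S' \<le> k + 1" for S'
        using step N that by auto
      define S' where "S' = S - {Suc N}"
      have finS: "finite S" using S finite_subset by blast
      have S': "S' \<subseteq> {1..N}" "card S' \<le> k + 1"
        using S finS card_Diff1_le[of S "Suc N"] by (auto simp: S'_def le_Suc_eq)
      have spanN: "spanning {1..N} (fst \<circ> y)"
        using spanning_mono[OF span1] step.hyps by auto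
      obtain v0 c0 where v0: "snd v0 = 1" "\<forall>i\<in>{1..N}. sgn (v0 \<bullet> y i + c0) = face_sign S' i"
        using IH[OF S'] unfolding upper_covectors_def by blast
      have "lex_signed (\<lambda>_. 1) (Suc N) y" using lex_signed_mono[OF lex2 N] .
      then obtain v c where v: "snd v = 1" "\<forall>i\<in>{1..N}. sgn (v \<bullet> y i + c) = face_sign S' i"
          "0 < v \<bullet> y (Suc N) + c"
        using lex_push[OF spanN _ _ v0(1), of "\<lambda>_. 1" c0] v0(2) step.hyps by auto
      show "face_sign S \<in> upper_covectors (Suc N) y"
      proof (cases "Suc N \<in> S")
        case False
        then have "S' = S" by (simp add: S'_def)
        then show ?thesis using v False
          by (intro upper_covectorsI[OF v(1), of _ _ c]) (auto simp: le_Suc_eq face_sign_def)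
      next
        case True
        have card': "card S' \<le> k" using S(2) True finS by (simp add: S'_def)
        have "card S' \<le> DIM('a) + 1" "S' \<subseteq> {1..n}" using card' k S' N by auto
        then obtain J where J: "S' \<subseteq> J" "J \<subseteq> {1..n}" "card J = DIM('a) + 1"
          using exists_subset_between[of S' "DIM('a) + 1" "{1..n}"] n by auto
        have "face_sign S' \<in> covectors N (fst \<circ> (fst \<circ> y))"
          using covectors_mono[OF faces[OF \<open>S' \<subseteq> {1..n}\<close> card']] N by simp
        moreover have "finite J" using J(2) finite_subset by blast
        ultimately obtain w d where w: "\<forall>i\<in>{1..N}. sgn (w \<bullet> (fst \<circ> y) i + d) = face_sign S' i"
            "w \<bullet> (fst \<circ> y) (Suc N) + d < 0"
          using lift_face_visible[of N "fst \<circ> y" e S' J] J gen[OF J(2,3)] step.hyps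
            lex_signed_mono[OF lex1 N] spanning_mono[OF span0, of "{1..N}"] by auto
        \<comment> \<open>w is negative at the new point, so adding a positive multiple of it makes the functional vanish there.\<close>
        define \<mu> where "\<mu> = (v \<bullet> y (Suc N) + c) / - (w \<bullet> fst (y (Suc N)) + d)"
        have \<mu>: "0 < \<mu>" using v(3) w(2) by (simp add: \<mu>_def divide_pos_neg)
        define v' where "v' = v + (\<mu> *\<^sub>R w, 0)"
        define c' where "c' = c + \<mu> * d"
        have val: "v' \<bullet> p + c' = (v \<bullet> p + c) + \<mu> * (w \<bullet> fst p + d)" for p
          by (simp add: v'_def c'_def inner_prod_def algebra_simps)
        have "sgn (v' \<bullet> y i + c') = face_sign S i" if i: "i \<in> {1..Suc N}" for i
        proof (cases "i = Suc N")
          case True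
          define t where "t = w \<bullet> fst (y (Suc N)) + d"
          have "t \<noteq> 0" using w(2) by (simp add: t_def)
          then have "v' \<bullet> y (Suc N) + c' = 0"
            unfolding val \<mu>_def t_def[symmetric] by simp
          then show ?thesis using True \<open>Suc N \<in> S\<close> by (simp add: face_sign_def)
        next
          case False
          then have "i \<in> {1..N}" using i by auto
          then have "0 \<le> v \<bullet> y i + c \<and> (v \<bullet> y i + c = 0 \<longleftrightarrow> i \<in> S')"
            "0 \<le> w \<bullet> fst (y i) + d \<and> (w \<bullet> fst (y i) + d = 0 \<longleftrightarrow> i \<in> S')"
            using v(2) w(1) unfolding sgn_eq_face_sign by auto
          moreover have "i \<in> S \<longleftrightarrow> i \<in> S'" using False by (simp add: S'_def)
          ultimately show ?thesis
            unfolding val sgn_eq_face_sign using \<mu>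
            by (simp add: add_nonneg_eq_0_iff)
        qed
        moreover have "snd v' = 1" using v(1) by (simp add: v'_def)
        ultimately show ?thesis by (intro upper_covectorsI) auto
      qed
    qed
  qed
  then show ?thesis using n S by blast
qed

lemma upper_covectors_subset_covectors: "upper_covectors n y \<subseteq> covectors n y"
  unfolding upper_covectors_def covectors_def by blast

text \<open>
  A configuration in general position has no \<open>DIM('a) + 1\<close> points in a hyperplane, which is the
  dual form of spanning once the labels are known to name different points.
\<close>

lemma general_position_spanning:
  fixes x :: "nat \<Rightarrow> 'a::euclidean_space"
  assumes gp: "general_position (x ` {1..n})" and inj: "inj_on x {1..n}"
    and J: "J \<subseteq> {1..n}" "card J = DIM('a) + 1"
  shows "spanning J x"
  unfolding spanning_def
proof (intro allI impI, rule ccontr)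
  fix v c assume v: "\<forall>i\<in>J. v \<bullet> x i + c = 0" "v \<noteq> 0"
  have "card (x ` J) = DIM('a) + 1" using J inj by (metis card_image inj_on_subset)
  moreover have "x ` J \<subseteq> {q. v \<bullet> q = - c}" using v(1) by (auto simp: eq_neg_iff_add_eq_0)
  moreover have "hyperplane {q. v \<bullet> q = - c}" using v(2) unfolding hyperplane_def by blast
  moreover have "x ` J \<subseteq> x ` {1..n}" using J(1) by blast
  ultimately show False using gp unfolding general_position_def by metis
qed

section \<open>Lex-liftings satisfy the signed condition\<close>

lemma lex_signed_cong:
  fixes y z :: "nat \<Rightarrow> 'a::euclidean_space \<times> real"
  assumes eq: "\<And>i. i \<in> {1..n} \<Longrightarrow> y i = z i" and lex: "lex_signed e n y"
  shows "lex_signed e n z"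
  unfolding lex_signed_def
proof (intro ballI allI impI)
  fix i v c
  assume i: "i \<in> {DIM('a) + 2..n}" and v: "snd v = 1"
    and H: "spanned_hyperplane (z ` {1..<i}) {q. v \<bullet> q + c = 0}"
  have "z ` {1..<i} = y ` {1..<i}" "z i = y i" using i eq by (auto intro!: image_cong)
  then show "0 < e i * (v \<bullet> z i + c)" using lex i v H unfolding lex_signed_def by metis
qed

text \<open>
  Being above or below a hyperplane is independent of the equation chosen for it, as long as its
  last coefficient is positive: any two such equations differ by a positive factor.
\<close>

lemma above_below_graph:
  fixes p :: "'a::euclidean_space \<times> real"
  assumes "snd v = 1"
  shows "above p {q. v \<bullet> q + c = 0} \<Longrightarrow> 0 < v \<bullet> p + c"
    and "below p {q. v \<bullet> q + c = 0} \<Longrightarrow> v \<bullet> p + c < 0"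
proof -
  have scale: "p \<bullet> w - d = snd w * (v \<bullet> p + c)"
    if w: "snd w > 0" "{q. v \<bullet> q + c = 0} = {q. q \<bullet> w = d}" for w d
  proof -
    have "p - (0, v \<bullet> p + c) \<in> {q. v \<bullet> q + c = 0}"
      using assms by (simp add: inner_prod_def algebra_simps)
    then have "(p - (0, v \<bullet> p + c)) \<bullet> w = d" unfolding w(2) by simp
    then show ?thesis by (simp add: inner_prod_def algebra_simps)
  qed
  show "above p {q. v \<bullet> q + c = 0} \<Longrightarrow> 0 < v \<bullet> p + c"
    unfolding above_def using scale by (metis diff_gt_0_iff_gt zero_less_mult_pos)
  show "below p {q. v \<bullet> q + c = 0} \<Longrightarrow> v \<bullet> p + c < 0"
    unfolding below_def using scale by (metis diff_less_0_iff_less less_asym mult_less_0_iff)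
qed

lemma lex_lifting_signed:
  fixes y :: "nat \<Rightarrow> 'a::euclidean_space \<times> real"
  assumes lift: "lex_lifting n x y"
    and e: "\<And>i. i \<in> {1..n} \<Longrightarrow> e i \<noteq> 0 \<and> 0 \<le> e i * snd (y i)"
  shows "lex_signed e n y"
  unfolding lex_signed_def
proof (intro ballI allI impI)
  fix i v c
  assume i: "i \<in> {DIM('a) + 2..n}" and v: "snd v = 1"
    and H: "spanned_hyperplane (y ` {1..<i}) {q. v \<bullet> q + c = 0}"
  have y: "snd (y i) \<noteq> 0" "snd (y i) > 0 \<longrightarrow> above (y i) {q. v \<bullet> q + c = 0}"
    "snd (y i) < 0 \<longrightarrow> below (y i) {q. v \<bullet> q + c = 0}"
    using lift i H unfolding lex_lifting_def by blast+
  have "e i \<noteq> 0" "0 \<le> e i * snd (y i)" using e[of i] i by auto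
  then consider "snd (y i) > 0" "e i > 0" | "snd (y i) < 0" "e i < 0"
    using y(1) by (auto simp: zero_le_mult_iff)
  then show "0 < e i * (v \<bullet> y i + c)"
  proof cases
    case 1
    then show ?thesis using y(2) above_below_graph(1)[OF v] by simp
  next
    case 2
    then show ?thesis using y(3) above_below_graph(2)[OF v] by (simp add: mult_neg_neg)
  qed
qed

section \<open>Realization on the boundary of a smooth strictly convex body\<close>

lemma covectors_fst_subset:
  fixes y :: "nat \<Rightarrow> 'a::euclidean_space \<times> real"
  shows "covectors n (fst \<circ> y) \<subseteq> covectors n y"
proof
  fix s assume "s \<in> covectors n (fst \<circ> y)"
  then obtain v c where "\<forall>i\<in>{1..n}. sgn (v \<bullet> (fst \<circ> y) i + c) = s i" unfolding covectors_def by blast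
  then have "\<forall>i\<in>{1..n}. sgn ((v, 0) \<bullet> y i + c) = s i" by (simp add: inner_prod_def)
  then show "s \<in> covectors n y" unfolding covectors_def by blast
qed

text \<open>
  The map \<open>(x, t) \<mapsto> (x / t, 1 / t)\<close> centered at \<open>p\<close> sends \<open>p + \<sigma> (z, 1)\<close> to \<open>(z, 1 / \<sigma>)\<close>. In affine
  functionals it exchanges the constant term with the last coefficient and multiplies values by the
  positive number \<open>\<sigma>\<close>.
\<close>

lemma covectors_projective:
  fixes z :: "nat \<Rightarrow> 'a::euclidean_space" and \<sigma> :: "nat \<Rightarrow> real" and p :: "'a \<times> real"
  assumes \<sigma>: "\<And>i. 0 < \<sigma> i"
  shows "covectors n (\<lambda>i. p + \<sigma> i *\<^sub>R (z i, 1)) = covectors n (\<lambda>i. (z i, 1 / \<sigma> i))"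
proof -
  have val: "sgn (w \<bullet> (p + \<sigma> i *\<^sub>R (z i, 1)) + d) = sgn ((fst w, d + w \<bullet> p) \<bullet> (z i, 1 / \<sigma> i) + snd w)"
    for w d i
  proof -
    have "w \<bullet> (p + \<sigma> i *\<^sub>R (z i, 1)) + d = \<sigma> i * ((fst w, d + w \<bullet> p) \<bullet> (z i, 1 / \<sigma> i) + snd w)"
      using \<sigma>[of i] by (simp add: inner_prod_def inner_add_right field_simps)
    then show ?thesis using \<sigma>[of i] by (simp add: sgn_mult)
  qed
  show ?thesis
  proof
    show "covectors n (\<lambda>i. p + \<sigma> i *\<^sub>R (z i, 1)) \<subseteq> covectors n (\<lambda>i. (z i, 1 / \<sigma> i))"
      unfolding covectors_def val by blast
    show "covectors n (\<lambda>i. (z i, 1 / \<sigma> i)) \<subseteq> covectors n (\<lambda>i. p + \<sigma> i *\<^sub>R (z i, 1))"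
    proof
      fix s assume "s \<in> covectors n (\<lambda>i. (z i, 1 / \<sigma> i))"
      then obtain V c where V: "\<forall>i\<in>{1..n}. sgn (V \<bullet> (z i, 1 / \<sigma> i) + c) = s i"
        unfolding covectors_def by blast
      define w where "w = (fst V, c)"
      have "\<forall>i\<in>{1..n}. sgn (w \<bullet> (p + \<sigma> i *\<^sub>R (z i, 1)) + (snd V - w \<bullet> p)) = s i"
        unfolding val using V by (simp add: w_def)
      then show "s \<in> covectors n (\<lambda>i. p + \<sigma> i *\<^sub>R (z i, 1))" unfolding covectors_def by blast
    qed
  qed
qed

lemma lowest_in_frontier:
  fixes K :: "('b::euclidean_space \<times> real) set"
  assumes "closed K" "x \<in> K" "\<And>q. q \<in> K \<Longrightarrow> snd x \<le> snd q"
  shows "x \<in> frontier K"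
proof -
  have "x \<notin> interior K"
  proof
    assume "x \<in> interior K"
    then obtain \<epsilon> where \<epsilon>: "\<epsilon> > 0" "ball x \<epsilon> \<subseteq> K" by (auto simp: mem_interior)
    have "x - (0, \<epsilon> / 2) \<in> ball x \<epsilon>" using \<epsilon>(1) by (simp add: dist_norm norm_prod_def)
    then have "snd x \<le> snd (x - (0, \<epsilon> / 2))" using \<epsilon>(2) assms(3) by blast
    then show False using \<epsilon>(1) by simp
  qed
  then show ?thesis using assms(1,2) by (simp add: frontier_def)
qed

lemma lowest_point_exists:
  fixes K :: "('b::euclidean_space \<times> real) set"
  assumes "convex_body K"
  shows "\<exists>p\<in>K. \<forall>q\<in>K. snd p \<le> snd q"
proof -
  have "K \<noteq> {}"
  proof
    assume "K = {}"
    then have "aff_dim K = -1" by simp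
    then show False using assms unfolding convex_body_def by simp
  qed
  then show ?thesis
    using assms unfolding convex_body_def
    by (intro continuous_attains_inf continuous_intros) auto
qed

text \<open>
  The segment between two lowest points consists of lowest points and would lie in the boundary.
\<close>

lemma lowest_point_unique:
  fixes K :: "('b::euclidean_space \<times> real) set"
  assumes K: "strictly_convex_body K" and p: "p \<in> K" "\<And>q. q \<in> K \<Longrightarrow> snd p \<le> snd q"
    and q: "q \<in> K" "snd q = snd p"
  shows "q = p"
proof (rule ccontr)
  assume "q \<noteq> p"
  have "convex K" "closed K"
    using K unfolding strictly_convex_body_def convex_body_def by (auto intro: compact_imp_closed)
  have "closed_segment p q \<subseteq> frontier K"
  proof
    fix x assume x: "x \<in> closed_segment p q"
    then obtain u where u: "x = (1 - u) *\<^sub>R p + u *\<^sub>R q" unfolding closed_segment_def by blast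
    have "snd x = snd p" unfolding u using q(2) by (simp add: left_diff_distrib)
    moreover have "x \<in> K" using x closed_segment_subset[OF p(1) q(1) \<open>convex K\<close>] by blast
    ultimately show "x \<in> frontier K" using lowest_in_frontier[OF \<open>closed K\<close>] p(2) by simp
  qed
  then show False using K \<open>q \<noteq> p\<close> unfolding strictly_convex_body_def by metis
qed

text \<open>
  This is where smoothness enters. A ray missing \<open>K\<close> would be separated from \<open>K\<close> by a hyperplane
  through \<open>p\<close>, which has to be the horizontal one by uniqueness. An upward ray lies strictly above
  it, so \<open>K\<close> would lie below it, hence in it, and would not be full-dimensional.
\<close>

lemma upward_ray_enters:
  fixes K :: "('b::euclidean_space \<times> real) set"
  assumes K: "smooth_body K" and p: "p \<in> K" "\<And>q. q \<in> K \<Longrightarrow> snd p \<le> snd q"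
  shows "\<exists>s>0. p + s *\<^sub>R (z, 1) \<in> K"
proof (rule ccontr)
  assume no: "\<not> ?thesis"
  have body: "convex_body K" and cc: "convex K" "closed K"
    using K unfolding smooth_body_def convex_body_def by (auto intro: compact_imp_closed)
  let ?R = "(\<lambda>s. p + s *\<^sub>R (z, 1::real)) ` {0<..}"
  have "convex ?R"
  proof -
    have "convex ((+) p ` ((\<lambda>s. s *\<^sub>R (z, 1::real)) ` {0<..}))"
      by (intro convex_translation convex_linear_image) (auto intro!: linearI simp: algebra_simps)
    then show ?thesis by (simp add: image_image)
  qed
  moreover have "K \<inter> ?R = {}" using no by auto
  moreover have "K \<noteq> {}" "?R \<noteq> {}" using p(1) by auto
  ultimately obtain a b where ab: "a \<noteq> 0" "\<forall>x\<in>K. a \<bullet> x \<le> b" "\<forall>x\<in>?R. b \<le> a \<bullet> x"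
    using separating_hyperplane_sets[of K ?R] cc(1) by blast
  define t where "t = a \<bullet> (z, 1)"
  \<comment> \<open>Letting s tend to 0 shows that the separating hyperplane passes through p.\<close>
  have le: "b - a \<bullet> p \<le> s * t" if "0 < s" for s
  proof -
    have "b \<le> a \<bullet> (p + s *\<^sub>R (z, 1))" using ab(3) that by blast
    then show ?thesis by (simp add: t_def inner_prod_def algebra_simps)
  qed
  have "a \<bullet> p \<le> b" using ab(2) p(1) by blast
  then have t: "0 \<le> t" using le[of 1] by simp
  have eq: "a \<bullet> p = b"
  proof (rule ccontr)
    assume "a \<bullet> p \<noteq> b"
    then have \<delta>: "0 < b - a \<bullet> p" using \<open>a \<bullet> p \<le> b\<close> by simp
    then have "0 < t" using le[of 1] by simp
    then have "b - a \<bullet> p \<le> (b - a \<bullet> p) / (2 * t) * t" using \<delta> by (intro le) simp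
    then show False using \<open>0 < t\<close> \<delta> by simp
  qed
  have "supporting_hyperplane_at K p {x. a \<bullet> x = b}"
    unfolding supporting_hyperplane_at_def using ab eq by (intro exI[of _ a] exI[of _ b]) auto
  moreover have "supporting_hyperplane_at K p {x. (0, -1) \<bullet> x = - snd p}"
    unfolding supporting_hyperplane_at_def using p
    by (intro exI[of _ "(0, -1)"] exI[of _ "- snd p"]) (auto simp: inner_prod_def zero_prod_def)
  moreover have "p \<in> frontier K" using lowest_in_frontier[OF cc(2) p] .
  then have "\<exists>!H. supporting_hyperplane_at K p H" using K unfolding smooth_body_def by blast
  ultimately have H: "{x. a \<bullet> x = b} = {x. (0, -1) \<bullet> x = - snd p}" by blast
  have "p + (fst a, 0) \<in> {x. (0, -1) \<bullet> x = - snd p}" by (simp add: inner_prod_def)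
  then have "a \<bullet> (p + (fst a, 0)) = b" unfolding H[symmetric] by simp
  then have "fst a \<bullet> fst a = 0" using eq by (simp add: inner_add_right) (simp add: inner_prod_def)
  then have a0: "fst a = 0" by simp
  then have "t = snd a" by (simp add: t_def inner_prod_def)
  then have a1: "0 < snd a" using t ab(1) a0 by (metis order_less_le prod.collapse zero_prod_def)
  have "K \<subseteq> {x. (0, 1) \<bullet> x = snd p}"
  proof
    fix x assume x: "x \<in> K"
    then have "a \<bullet> x \<le> a \<bullet> p" using ab(2) eq by blast
    then have "snd a * snd x \<le> snd a * snd p" using a0 by (simp add: inner_prod_def)
    then have "snd x \<le> snd p" using a1 by simp
    then show "x \<in> {x. (0, 1) \<bullet> x = snd p}" using p(2)[OF x] by (simp add: inner_prod_def)
  qed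
  then have "aff_dim K \<le> aff_dim {x :: 'b \<times> real. (0, 1) \<bullet> x = snd p}" by (rule aff_dim_subset)
  also have "\<dots> = int DIM('b \<times> real) - 1" 
    using aff_dim_hyperplane[of "(0, 1) :: 'b \<times> real" "snd p"] by (simp add: zero_prod_def)
  finally show False using body unfolding convex_body_def by simp
qed

lemma upward_ray_meets_frontier:
  fixes K :: "('b::euclidean_space \<times> real) set"
  assumes K: "smooth_body K" and p: "p \<in> K" "\<And>q. q \<in> K \<Longrightarrow> snd p \<le> snd q"
  shows "\<exists>s>0. p + s *\<^sub>R (z, 1) \<in> frontier K"
proof -
  obtain s0 where s0: "s0 > 0" "p + s0 *\<^sub>R (z, 1) \<in> K"
    using upward_ray_enters[OF K p] by blast
  let ?R = "(\<lambda>s. p + s *\<^sub>R (z, 1::real)) ` {s0..}"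
  have "bounded K" using K unfolding smooth_body_def convex_body_def by (auto intro: compact_imp_bounded)
  then obtain M where M: "\<forall>x\<in>K. norm x \<le> M" unfolding bounded_iff by blast
  define s1 where "s1 = max s0 (M - snd p + 1)"
  have "p + s1 *\<^sub>R (z, 1) \<notin> K"
  proof
    assume "p + s1 *\<^sub>R (z, 1) \<in> K"
    then have "norm (p + s1 *\<^sub>R (z, 1)) \<le> M" using M by blast
    moreover have "\<bar>snd (p + s1 *\<^sub>R (z, 1))\<bar> \<le> norm (p + s1 *\<^sub>R (z, 1))"
      by (metis norm_snd_le prod.collapse real_norm_def)
    ultimately show False by (simp add: s1_def)
  qed
  moreover have "p + s1 *\<^sub>R (z, 1) \<in> ?R" by (rule imageI) (simp add: s1_def)
  ultimately have "?R - K \<noteq> {}" by blast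
  moreover have "?R \<inter> K \<noteq> {}" using s0 by auto
  moreover have "connected ?R" by (intro connected_continuous_image continuous_intros) auto
  ultimately have "?R \<inter> frontier K \<noteq> {}" by (intro connected_Int_frontier) auto
  then show ?thesis using s0(1) by force
qed

text \<open>
  This is where strict convexity enters. The points of \<open>K\<close> at distance at least \<open>\<epsilon>\<close> from \<open>p\<close> are
  higher than \<open>p\<close> by some \<open>\<delta> > 0\<close>, by compactness and uniqueness of the lowest point. Reaching height
  \<open>\<delta>\<close> in direction \<open>(z, 1)\<close> takes a horizontal distance of \<open>\<delta> * norm z\<close>, which \<open>K\<close> does not have
  room for when \<open>z\<close> is long.
\<close>

lemma radial_points_converge:
  fixes K :: "('b::euclidean_space \<times> real) set" and \<sigma> :: "'b \<Rightarrow> real"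
  assumes K: "strictly_convex_body K" and p: "p \<in> K" "\<And>q. q \<in> K \<Longrightarrow> snd p \<le> snd q"
    and \<sigma>: "\<And>z. 0 < \<sigma> z" "\<And>z. p + \<sigma> z *\<^sub>R (z, 1) \<in> K" and \<epsilon>: "0 < \<epsilon>"
  shows "\<exists>R. \<forall>z. R \<le> norm z \<longrightarrow> norm (\<sigma> z *\<^sub>R (z, 1::real)) < \<epsilon>"
proof -
  have cpt: "compact K" using K unfolding strictly_convex_body_def convex_body_def by auto
  define K' where "K' = K \<inter> {q. \<epsilon> \<le> norm (q - p)}"
  have cpt': "compact K'"
    unfolding K'_def using cpt
    by (intro compact_Int_closed closed_Collect_le continuous_intros) auto
  obtain M where M: "\<forall>x\<in>K. norm x \<le> M" using compact_imp_bounded[OF cpt] unfolding bounded_iff by blast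
  have "\<exists>\<delta>>0. \<forall>q\<in>K'. \<delta> \<le> snd q - snd p"
  proof (cases "K' = {}")
    case False
    then obtain m where m: "m \<in> K'" "\<forall>q\<in>K'. snd m \<le> snd q"
      using continuous_attains_inf[OF cpt' _ continuous_on_snd[OF continuous_on_id]] by auto
    have "m \<noteq> p" "m \<in> K" using m(1) \<epsilon> by (auto simp: K'_def)
    then have "snd p < snd m"
      using lowest_point_unique[OF K p \<open>m \<in> K\<close>] p(2) by (metis order_less_le)
    then show ?thesis using m(2) by (intro exI[of _ "snd m - snd p"]) auto
  qed (auto intro: exI[of _ 1])
  then obtain \<delta> where \<delta>: "\<delta> > 0" "\<forall>q\<in>K'. \<delta> \<le> snd q - snd p" by blast
  show ?thesis
  proof (intro exI allI impI, rule ccontr)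
    fix z :: 'b
    assume z: "2 * (\<bar>M\<bar> + 1) / \<delta> \<le> norm z" and "\<not> norm (\<sigma> z *\<^sub>R (z, 1::real)) < \<epsilon>"
    then have "p + \<sigma> z *\<^sub>R (z, 1) \<in> K'" using \<sigma>(2)[of z] by (simp add: K'_def)
    then have \<delta>\<sigma>: "\<delta> \<le> \<sigma> z" using \<delta>(2) by fastforce
    have "2 * (\<bar>M\<bar> + 1) \<le> \<delta> * norm z" using z \<delta>(1) by (simp add: field_simps)
    also have "\<dots> \<le> \<sigma> z * norm z" using \<delta>\<sigma> by (simp add: mult_right_mono)
    also have "\<dots> = norm (fst (\<sigma> z *\<^sub>R (z, 1::real)))" using \<sigma>(1)[of z] by simp
    also have "\<dots> \<le> norm (\<sigma> z *\<^sub>R (z, 1::real))" by (metis norm_fst_le prod.collapse)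
    also have "\<dots> \<le> norm (p + \<sigma> z *\<^sub>R (z, 1)) + norm p"
      using norm_triangle_ineq4[of "p + \<sigma> z *\<^sub>R (z, 1)" p] by simp
    also have "\<dots> \<le> M + M" using M \<sigma>(2) p(1) by (intro add_mono) auto
    finally show False by simp
  qed
qed

text \<open>
  Normalizing the last coefficient makes the equation of a graph hyperplane unique, and finitely many
  points span finitely many hyperplanes.
\<close>

lemma finite_spanned_graphs:
  fixes X :: "('b::euclidean_space \<times> real) set"
  assumes "finite X"
  shows "finite {(v, c). snd v = 1 \<and> spanned_hyperplane X {q. v \<bullet> q + c = 0}}"
    (is "finite ?G")
proof (rule finite_imageD)
  let ?H = "\<lambda>(v, c). {q. v \<bullet> q + c = 0} :: ('b \<times> real) set"
  have "?H ` ?G \<subseteq> (\<lambda>S. affine hull S) ` Pow X" unfolding spanned_hyperplane_def by auto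
  then show "finite (?H ` ?G)" by (rule finite_subset) (simp add: assms)
  show "inj_on ?H ?G"
  proof (rule inj_onI, clarify)
    fix u u' :: 'b and a a' c c' :: real
    assume eq: "{q. (u, a) \<bullet> q + c = 0} = {q. (u', a') \<bullet> q + c' = 0}"
      and "snd (u, a) = 1" "snd (u', a') = 1"
    then have one: "a = 1" "a' = 1" by auto
    have same: "u \<bullet> q + c = u' \<bullet> q + c'" for q
    proof -
      have "(q, - (u \<bullet> q) - c) \<in> {q. (u, a) \<bullet> q + c = 0}" by (simp add: one inner_prod_def)
      then show ?thesis unfolding eq by (simp add: one inner_prod_def)
    qed
    have "c = c'" using same[of 0] by simp
    then have "u = u'" using same vector_eq_ldot[of u u'] by (metis add_right_cancel inner_commute vector_eq_rdot)
    then show "(u, a) = (u', a') \<and> c = c'" using one \<open>c = c'\<close> by simp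
  qed
qed

text \<open>
  The heights \<open>h i\<close> are chosen recursively. In the recursive step finitely many conditions have to
  hold, and each of them holds once \<open>e i * h i\<close> is large: for the lifting \<open>Z\<close> of the base because the last
  coordinate of the new point dominates, and for the lifting \<open>Y\<close> of \<open>Z\<close>, which consists of points of the
  projectively transformed boundary, because the transformed boundary is superlinear.
\<close>

lemma inscribed_configuration:
  fixes y :: "nat \<Rightarrow> ('a::euclidean_space \<times> real) \<times> real" and K :: "(('a \<times> real) \<times> real) set"
  assumes span0: "spanning {1..DIM('a) + 1} (fst \<circ> (fst \<circ> y))"
    and lex1: "lex_signed e n (fst \<circ> y)" and e: "\<And>i. e i = 1 \<or> e i = -1"
    and lex2: "lex_signed (\<lambda>_. 1) n y"
    and n: "DIM('a) + 2 \<le> n" and K: "smooth_body K" "strictly_convex_body K"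
  shows "\<exists>B. (\<forall>i. B i \<in> frontier K) \<and> covectors n B = covectors n y"
proof -
  have body: "convex_body K" using K(1) unfolding smooth_body_def by blast
  then have "closed K" unfolding convex_body_def by (auto intro: compact_imp_closed)
  obtain p where p: "p \<in> K" "\<And>q. q \<in> K \<Longrightarrow> snd p \<le> snd q" using lowest_point_exists[OF body] by blast
  obtain \<sigma> where \<sigma>: "\<And>z. 0 < \<sigma> z" "\<And>z. p + \<sigma> z *\<^sub>R (z, 1) \<in> frontier K"
    using upward_ray_meets_frontier[OF K(1) p] by metis
  have \<sigma>K: "p + \<sigma> z *\<^sub>R (z, 1) \<in> K" for z using \<sigma>(2) frontier_subset_closed[OF \<open>closed K\<close>] by blast
  define x where "x = fst \<circ> (fst \<circ> y)"
  define Z where "Z = (\<lambda>(h::nat \<Rightarrow> real) i. (x i, h i))"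
  define Y where "Y = (\<lambda>h i. (Z h i, 1 / \<sigma> (Z h i)))"
  define good where "good = (\<lambda>h i r.
    (\<forall>(v, c) \<in> {(v, c). snd v = 1 \<and> spanned_hyperplane (Z h ` {1..<i}) {q. v \<bullet> q + c = 0}}.
       0 < e i * (v \<bullet> (x i, r) + c)) \<and>
    (\<forall>(v, c) \<in> {(v, c). snd v = 1 \<and> spanned_hyperplane (Y h ` {1..<i}) {q. v \<bullet> q + c = 0}}.
       0 < v \<bullet> ((x i, r), 1 / \<sigma> (x i, r)) + c))"
  have "\<exists>h. \<forall>i. good h i (h i)"
  proof (rule dependent_wellorder_choice)
    fix r :: real and f g :: "nat \<Rightarrow> real" and i :: nat
    assume "\<And>j. j < i \<Longrightarrow> f j = g j"
    then have "Z f ` {1..<i} = Z g ` {1..<i}" "Y f ` {1..<i} = Y g ` {1..<i}"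
      by (auto simp: Y_def Z_def intro!: image_cong)
    then show "good f i r = good g i r" unfolding good_def by simp
  next
    fix i :: nat and h :: "nat \<Rightarrow> real"
    have 1: "\<forall>\<^sub>F r in at_top. 0 < e i * (v \<bullet> (x i, e i * r) + c)" if "snd v = 1" for v c
    proof -
      have "e i * (v \<bullet> (x i, e i * r) + c) = e i * (fst v \<bullet> x i + c) + r" for r
        using e[of i] that by (auto simp: inner_prod_def algebra_simps)
      moreover have "\<forall>\<^sub>F r in at_top. 0 < e i * (fst v \<bullet> x i + c) + r"
        using eventually_gt_at_top[of "- (e i * (fst v \<bullet> x i + c))"] by eventually_elim simp
      ultimately show ?thesis by simp
    qed
    have 2: "\<forall>\<^sub>F r in at_top. 0 < v \<bullet> ((x i, e i * r), 1 / \<sigma> (x i, e i * r)) + c" if "snd v = 1" for v c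
    proof -
      define w where "w = (fst v, c)"
      have "0 < 1 / (norm w + 1)" by (simp add: add_nonneg_pos)
      then obtain R where R: "\<And>z. R \<le> norm z \<Longrightarrow> norm (\<sigma> z *\<^sub>R (z, 1::real)) < 1 / (norm w + 1)"
        using radial_points_converge[OF K(2) p \<sigma>(1) \<sigma>K] by blast
      show ?thesis
        using eventually_ge_at_top[of "\<bar>R\<bar>"]
      proof eventually_elim
        case (elim r)
        define z where "z = (x i, e i * r)"
        have "R \<le> \<bar>snd z\<bar>" using elim e[of i] by (auto simp: z_def)
        also have "\<dots> \<le> norm z" by (metis norm_snd_le prod.collapse real_norm_def)
        finally have small: "norm (\<sigma> z *\<^sub>R (z, 1::real)) < 1 / (norm w + 1)" by (rule R)
        have "\<bar>w \<bullet> (\<sigma> z *\<^sub>R (z, 1))\<bar> \<le> norm w * norm (\<sigma> z *\<^sub>R (z, 1::real))"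
          by (rule Cauchy_Schwarz_ineq2)
        also have "\<dots> \<le> norm w * (1 / (norm w + 1))" using small by (intro mult_left_mono) auto
        also have "\<dots> < 1" by (simp add: divide_less_eq add_nonneg_pos)
        \<comment> \<open>The value at the boundary point is close to the value 1 at p.\<close>
        finally have "0 < w \<bullet> (\<sigma> z *\<^sub>R (z, 1)) + 1" by linarith
        moreover have "w \<bullet> (\<sigma> z *\<^sub>R (z, 1)) + 1 = \<sigma> z * (v \<bullet> (z, 1 / \<sigma> z) + c)"
          using that \<sigma>(1)[of z] by (simp add: w_def inner_prod_def field_simps)
        ultimately have "0 < v \<bullet> (z, 1 / \<sigma> z) + c"
          using \<sigma>(1)[of z] by (simp add: zero_less_mult_iff)
        then show ?case by (simp add: z_def)
      qed
    qed
    have "\<forall>\<^sub>F r in at_top. good h i (e i * r)"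
      unfolding good_def
    proof (intro eventually_conj eventually_ball_finite finite_spanned_graphs ballI finite_imageI
        finite_atLeastLessThan)
      fix w assume "w \<in> {(v, c). snd v = 1 \<and> spanned_hyperplane (Z h ` {1..<i}) {q. v \<bullet> q + c = 0}}"
      then obtain v c where "w = (v, c)" "snd v = 1" by blast
      then show "\<forall>\<^sub>F r in at_top. case w of (v, c) \<Rightarrow> 0 < e i * (v \<bullet> (x i, e i * r) + c)"
        using 1[of v c] by simp
    next
      fix w assume "w \<in> {(v, c). snd v = 1 \<and> spanned_hyperplane (Y h ` {1..<i}) {q. v \<bullet> q + c = 0}}"
      then obtain v c where "w = (v, c)" "snd v = 1" by blast
      then show "\<forall>\<^sub>F r in at_top. case w of (v, c) \<Rightarrow>
          0 < v \<bullet> ((x i, e i * r), 1 / \<sigma> (x i, e i * r)) + c"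
        using 2[of v c] by simp
    qed
    then show "\<exists>r. good h i r" using eventually_happens' trivial_limit_at_top_linorder by blast
  qed
  then obtain h where h: "\<And>i. good h i (h i)" by blast
  have lexZ: "lex_signed e n (Z h)" and lexY: "lex_signed (\<lambda>_. 1) n (Y h)"
    using h unfolding lex_signed_def good_def by (auto simp: Z_def Y_def)
  have fstY: "fst \<circ> Y h = Z h" and fstZ: "fst \<circ> Z h = x" by (auto simp: Y_def Z_def)
  have cov1: "covectors n (Z h) = covectors n (fst \<circ> y)"
    by (rule covectors_lex_lift[where e = e])
      (use span0 lexZ lex1 n in \<open>auto simp: fstZ x_def\<close>)
  have span1: "spanning {1..DIM('a) + 2} (fst \<circ> y)" "spanning {1..DIM('a) + 2} (Z h)"
    using spanning_lex_lift[OF _ lex_signed_mono[OF lex1 n]]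
      spanning_lex_lift[OF _ lex_signed_mono[OF lexZ n]] span0
    unfolding fstZ x_def by blast+
  have "covectors n (Y h) = covectors n y"
    by (rule covectors_lex_lift[where e = "\<lambda>_. 1"])
      (use span1 lexY lex2 cov1 n in \<open>auto simp: fstY\<close>)
  moreover have "covectors n (\<lambda>i. p + \<sigma> (Z h i) *\<^sub>R (Z h i, 1)) = covectors n (Y h)"
    unfolding Y_def by (rule covectors_projective) (rule \<sigma>(1))
  ultimately show ?thesis using \<sigma>(2)
    by (intro exI[of _ "\<lambda>i. p + \<sigma> (Z h i) *\<^sub>R (Z h i, 1)"]) auto
qed

section \<open>Assembling the theorem\<close>

lemma k_neighborly_covectors:
  fixes x :: "nat \<Rightarrow> 'a::euclidean_space"
  assumes lab: "vertex_labeling n x P" and P: "P = convex hull (x ` {1..n})"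
  shows "k_neighborly k P \<longleftrightarrow> (\<forall>S. S \<subseteq> {1..n} \<and> card S = k \<longrightarrow> face_sign S \<in> covectors n x)"
proof -
  have vert: "vertices P = x ` {1..n}" and inj: "inj_on x {1..n}"
    using lab unfolding vertex_labeling_def bij_betw_def by auto
  have poly: "polytope P" unfolding P by (rule polytope_hull_image)
  have lattice: "(\<exists>F. F face_of P \<and> vertices F = x ` S) \<longleftrightarrow> face_sign S \<in> covectors n x"
    if "S \<subseteq> {1..n}" for S
    using face_lattice_covectors[OF lab P] that unfolding face_lattice_def by blast
  have card: "card (x ` S) = card S" if "S \<subseteq> {1..n}" for S
    using that inj by (meson card_image inj_on_subset)
  show ?thesis
  proof
    assume "k_neighborly k P"
    then show "\<forall>S. S \<subseteq> {1..n} \<and> card S = k \<longrightarrow> face_sign S \<in> covectors n x"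
      unfolding k_neighborly_def vert using lattice card by (metis image_mono)
  next
    assume R: "\<forall>S. S \<subseteq> {1..n} \<and> card S = k \<longrightarrow> face_sign S \<in> covectors n x"
    show "k_neighborly k P"
      unfolding k_neighborly_def vert
    proof (intro conjI allI impI poly)
      fix T assume T: "T \<subseteq> x ` {1..n} \<and> card T = k"
      then obtain S where "S \<subseteq> {1..n}" "T = x ` S" by (meson subset_imageE)
      then show "\<exists>F. F face_of P \<and> vertices F = T" using R T lattice card by metis
    qed
  qed
qed

lemma vertex_singleton_covector:
  fixes x :: "nat \<Rightarrow> 'a::euclidean_space"
  assumes lab: "vertex_labeling n x P" and P: "P = convex hull (x ` {1..n})" and i: "i \<in> {1..n}"
  shows "face_sign {i} \<in> covectors n x"
proof -
  have "x i \<in> vertices P" using lab i unfolding vertex_labeling_def bij_betw_def by blast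
  then have "{x i} face_of P" by (simp add: vertices_def face_of_singleton)
  moreover have "vertices {x i} = x ` {i}" by (auto simp: vertices_def extreme_point_of_def)
  ultimately have "{i} \<in> face_lattice n x P" using i unfolding face_lattice_def by blast
  then show ?thesis using face_lattice_covectors[OF lab P] by blast
qed

lemma hull_of_labeled_vertices:
  assumes "polytope P" "vertex_labeling n x P"
  shows "P = convex hull (x ` {1..n})"
proof -
  have "P = convex hull (vertices P)"
    unfolding vertices_def
    using Krein_Milman_Minkowski polytope_imp_compact polytope_imp_convex assms(1) by blast
  then show ?thesis using assms(2) unfolding vertex_labeling_def bij_betw_def by simp
qed

text \<open>
  A functional vanishing on \<open>DIM('a) + 1\<close> points in general position is \<open>0\<close> everywhere, but the one that
  supports a proper subset of the points is positive outside it.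
\<close>

lemma supported_set_small:
  fixes x :: "nat \<Rightarrow> 'a::euclidean_space"
  assumes gen: "\<And>J. J \<subseteq> {1..n} \<Longrightarrow> card J = DIM('a) + 1 \<Longrightarrow> spanning J x"
    and S: "S \<subset> {1..n}" "face_sign S \<in> covectors n x"
  shows "card S \<le> DIM('a)"
proof (rule ccontr)
  assume "\<not> ?thesis"
  then obtain J where J: "J \<subseteq> S" "card J = DIM('a) + 1"
    by (metis Suc_eq_plus1 not_less_eq_eq obtain_subset_with_card_n)
  obtain v c where vc: "\<forall>i\<in>{1..n}. 0 \<le> v \<bullet> x i + c \<and> (v \<bullet> x i + c = 0 \<longleftrightarrow> i \<in> S)"
    using S(2) unfolding face_sign_covectors_iff by blast
  have zero: "\<forall>i\<in>J. v \<bullet> x i + c = 0" using vc J(1) S(1) by blast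
  have "J \<subseteq> {1..n}" using J(1) S(1) by blast
  then have "v = 0" using gen[OF _ J(2)] zero unfolding spanning_def by blast
  moreover obtain j where "j \<in> J" using J(2) by fastforce
  ultimately have "c = 0" using zero by auto
  moreover obtain i where "i \<in> {1..n}" "i \<notin> S" using S(1) by blast
  ultimately show False using vc \<open>v = 0\<close> by auto
qed

theorem theorem5p5:
  fixes A :: "nat \<Rightarrow> 'a::euclidean_space"
    and A1 :: "nat \<Rightarrow> 'a \<times> real"
    and A2 :: "nat \<Rightarrow> ('a \<times> real) \<times> real"
    and P :: "'a set"
    and P2 :: "(('a \<times> real) \<times> real) set"
    and n k :: nat
  assumes "n \<ge> DIM('a) + 3"
    and "general_position (A ` {1..n})"
    and "dim_polytope DIM('a) P"
    and "vertex_labeling n A P"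
    and "k_neighborly k P"
    and "lex_lifting n A A1"
    and "positive_lex_lifting n A1 A2"
    and "P2 = convex hull (A2 ` {1..n})"
  shows "(dim_polytope (DIM('a) + 2) P2 \<and> k_neighborly (k + 1) P2 \<and>
            (neighborly P \<longrightarrow> neighborly P2)) \<and>
         (\<forall>K :: (('a \<times> real) \<times> real) set. smooth_body K \<and> strictly_convex_body K \<longrightarrow>
            (\<exists>Q B. inscribed K Q \<and> combinatorially_equivalent n A2 P2 B Q))"
proof -
  define e :: "nat \<Rightarrow> real" where "e = (\<lambda>i. if snd (A1 i) < 0 then - 1 else 1)"
  have e: "e i = 1 \<or> e i = - 1" for i by (simp add: e_def)
  have poly: "polytope P" using assms(3) unfolding dim_polytope_def by blast
  have P: "P = convex hull (A ` {1..n})" using hull_of_labeled_vertices[OF poly assms(4)] .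
  have inj: "inj_on A {1..n}" using assms(4) unfolding vertex_labeling_def bij_betw_def by blast
  have gen: "spanning J A" if "J \<subseteq> {1..n}" "card J = DIM('a) + 1" for J
    using general_position_spanning[OF assms(2) inj that] .

  have A2: "fst (A2 i) = A1 i" if "i \<in> {1..n}" for i
    using assms(7) that unfolding positive_lex_lifting_def lex_lifting_def by blast
  have A1: "fst (A1 i) = A i" if "i \<in> {1..n}" for i
    using assms(6) that unfolding lex_lifting_def by blast
  \<comment> \<open>The first lift is replaced by the projection of the second, which agrees with it on the labels and makes all three configurations projections of one.\<close>
  have lex1: "lex_signed e n (fst \<circ> A2)"
  proof (rule lex_signed_cong)
    show "lex_signed e n A1" by (rule lex_lifting_signed[OF assms(6)]) (simp add: e_def)
  qed (simp add: A2)
  have lex2: "lex_signed (\<lambda>_. 1) n A2"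
    using assms(7) unfolding positive_lex_lifting_def by (intro lex_lifting_signed) auto
  have gen2: "spanning J (fst \<circ> (fst \<circ> A2))" if J: "J \<subseteq> {1..n}" "card J = DIM('a) + 1" for J
  proof -
    have "(fst \<circ> (fst \<circ> A2)) i = A i" if "i \<in> J" for i using J(1) that A1 A2 by auto
    then show ?thesis using gen[OF J] unfolding spanning_def by simp
  qed
  have n: "DIM('a) + 2 \<le> n" using assms(1) by simp
  have span0: "spanning {1..DIM('a) + 1} (fst \<circ> (fst \<circ> A2))" using n by (intro gen2) auto
  have span1: "spanning {1..DIM('a) + 2} (fst \<circ> A2)"
    by (rule spanning_lex_lift[OF span0 lex_signed_mono[OF lex1 n]])
  have span2: "spanning {1..DIM('a) + 3} A2"
    using spanning_lex_lift[of A2 "\<lambda>_. 1"] span1 lex_signed_mono[OF lex2 assms(1)]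
    by (simp add: numeral_3_eq_3)
  have covA: "covectors n (fst \<circ> (fst \<circ> A2)) = covectors n A"
    by (rule covectors_cong) (simp add: A1 A2)
  have vertical: "covectors n A \<subseteq> covectors n A2"
    using covectors_fst_subset[of n "fst \<circ> A2"] covectors_fst_subset[of n A2] covA by blast

  have single: "face_sign {i} \<in> covectors n A2" if "i \<in> {1..n}" for i
    using vertex_singleton_covector[OF assms(4) P that] vertical by blast
  have lab2: "vertex_labeling n A2 P2" unfolding assms(8) using single by (rule vertex_labelingI)
  have poly2: "polytope P2" unfolding assms(8) by (rule polytope_hull_image)
  have "aff_dim (A2 ` {1..n}) = int (DIM('a) + 2)"
    using spanning_aff_dim[OF spanning_mono[OF span2, of "{1..n}"]] assms(1) by simp
  then have dim: "dim_polytope (DIM('a) + 2) P2"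
    using poly2 unfolding dim_polytope_def assms(8) by (simp add: aff_dim_convex_hull)

  have neighborly_step: "k_neighborly (k + 1) P2" if k: "k_neighborly k P" for k
    unfolding k_neighborly_covectors[OF lab2 assms(8)]
  proof (intro allI impI)
    fix S assume S: "S \<subseteq> {1..n} \<and> card S = k + 1"
    then have "k + 1 \<le> n" using card_mono[of "{1..n}" S] by simp
    have faces: "face_sign T \<in> covectors n A" if "T \<subseteq> {1..n}" "card T = k" for T
      using k that unfolding k_neighborly_covectors[OF assms(4) P] by blast
    have small: "face_sign T \<in> covectors n (fst \<circ> (fst \<circ> A2))" if "T \<subseteq> {1..n}" "card T \<le> k" for T
      unfolding covA using face_sign_small_sets[OF faces _ that] \<open>k + 1 \<le> n\<close> by simp
    have "{1..k} \<subseteq> {1..n}" "{1..k} \<subset> {1..n}" using \<open>k + 1 \<le> n\<close> by auto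
    then have "card {1..k} \<le> DIM('a)"
      using supported_set_small[OF gen _ faces] by simp
    then have "k \<le> DIM('a)" by simp
    then have "face_sign S \<in> upper_covectors n A2"
      using double_lift_lower_faces[OF gen2 lex1 lex2 small _ n] S by simp
    then show "face_sign S \<in> covectors n A2" using upper_covectors_subset_covectors by blast
  qed
  have neighborly: "neighborly P2" if nb: "neighborly P"
  proof -
    obtain d where d: "dim_polytope d P" "k_neighborly (d div 2) P"
      using nb unfolding neighborly_def by blast
    then have "d = DIM('a)" using assms(3) unfolding dim_polytope_def by simp
    then have "k_neighborly ((DIM('a) + 2) div 2) P2" using neighborly_step[OF d(2)] by simp
    then show ?thesis using dim unfolding neighborly_def by blast
  qed

  have inscribable: "\<exists>Q B. inscribed K Q \<and> combinatorially_equivalent n A2 P2 B Q"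
    if K: "smooth_body K" "strictly_convex_body K" for K :: "(('a \<times> real) \<times> real) set"
  proof -
    obtain B where B: "\<And>i. B i \<in> frontier K" "covectors n B = covectors n A2"
      using inscribed_configuration[OF span0 lex1 e lex2 n K] by blast
    define Q where "Q = convex hull (B ` {1..n})"
    have labQ: "vertex_labeling n B Q" unfolding Q_def using single by (intro vertex_labelingI) (simp add: B(2))
    have polyQ: "polytope Q" unfolding Q_def by (rule polytope_hull_image)
    have "face_lattice n A2 P2 = face_lattice n B Q"
      using face_lattice_covectors[OF lab2 assms(8)] face_lattice_covectors[OF labQ Q_def] B(2) by simp
    moreover have "vertices Q \<subseteq> frontier K"
      using labQ B(1) unfolding vertex_labeling_def bij_betw_def by (metis image_subsetI)
    ultimately show ?thesis
      unfolding inscribed_def combinatorially_equivalent_def using lab2 labQ poly2 polyQ by blast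
  qed
  show ?thesis using dim neighborly_step[OF assms(5)] neighborly inscribable by blast
qed

end
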